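(* Let $q\geq 3$ be an integer and $p\in(0,1)$, let $(Z_n)_{n\ge 0}$ be the lamplighter random walk on $\mathcal{L}_q=(\mathbb{Z}/2)\wr\mathcal{T}_q$ described in the context, and let $\ell=\lim_{n\to\infty}\ell(Z_n)/n$ be its rate of escape. Then $$\ell\ \geq\ \frac{(1-p)(q-2)}{q}\Bigl(1+\frac{2q}{q-1}\,\widehat\nu_3+\frac{pq}{pq+q-2}\Bigr),$$ where $$\widehat\nu_3=\frac{p(q-2+p)}{q(pq+q-2)(1-\bar F)\bigl(1-(1-p)\bar F\bigr)},\qquad \bar F=\frac{q-\sqrt{q^2-4(q-1)(1-p)^2}}{2(q-1)(1-p)}.$$
   Context: Let $\mathcal{S}=\{a_1,\dots,a_q\}$ and let $\mathcal{T}_q$ be the free product of $q$ copies of $\mathbb{Z}/2$ generated by the $a_i$ (so $a_i^{-1}=a_i$); its elements are the finite words over $\mathcal{S}$ with no two equal consecutive letters, the identity is the empty word $o$, and its Cayley graph with respect to $\mathcal{S}$ is the homogeneous tree of degree $q$. $\mathcal{N}$ is the set of finitely supported functions $\eta:\mathcal{T}_q\to\mathbb{Z}/2=\{0,1\}$ (lamp configurations), $\mathbf{0}$ is the zero function, $\mathbf{1}_o$ is the indicator function of $\{o\}$, and $(x\eta)(w):=\eta(x^{-1}w)$. The group $\mathcal{L}_q=(\mathbb{Z}/2)\wr\mathcal{T}_q$ is the set $\mathcal{N}\times\mathcal{T}_q$ with the product $(\eta_1,x)(\eta_2,y)=(\eta_1\oplus x\eta_2,\,xy)$, where $\oplus$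 is pointwise addition mod 2; its identity is $(\mathbf{0},o)$. Let $\mathcal{S}_{\mathcal{L}_q}=\{(\mathbf{1}_o,o)\}\cup\{(\mathbf{0},a):a\in\mathcal{S}\}$. For $(\eta,x)\in\mathcal{L}_q$, $\ell((\eta,x))$ is the length of a shortest path from $(\eta,x)$ to $(\mathbf{0},o)$ in the Cayley graph of $\mathcal{L}_q$ with respect to $\mathcal{S}_{\mathcal{L}_q}$ (edges $g\sim gs$). Random walk: $\mathbf{i}_1,\mathbf{i}_2,\dots$ are i.i.d. $\mathcal{L}_q$-valued with law $\mu$, where $\mu((\mathbf{1}_o,o))=p$ and $\mu((\mathbf{0},a))=(1-p)/q$ for each $a\in\mathcal{S}$; $Z_0=(\mathbf{0},o)$ and $Z_n=Z_{n-1}\mathbf{i}_n$. The rate of escape $\ell=\lim_{n\to\infty}\ell(Z_n)/n$ exists almost surely and is almost surely constant (Kingman's subadditive ergodic theorem). *)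

theory Defs
  imports "HOL-Probability.Probability" "HOL-Algebra.Group" "HOL-Library.Z2"
begin

section \<open>The free product of \<open>q\<close> copies of \<open>\<int>/2\<close>\<close>

text \<open>The letters are the numbers \<open>0, \<dots>, q - 1\<close>. Left multiplication of a reduced word
  by a letter cancels if the word starts with that letter, since letters are involutions.\<close>

fun push_letter :: "nat \<Rightarrow> nat list \<Rightarrow> nat list" where
  "push_letter a [] = [a]"
| "push_letter a (b # w) = (if a = b then w else a # b # w)"

definition tree_group :: "nat \<Rightarrow> nat list monoid" where
  "tree_group q =
    \<lparr>carrier = {w. set w \<subseteq> {..<q} \<and> distinct_adj w},
     mult = (\<lambda>u v. foldr push_letter u v),
     one = []\<rparr>"

section \<open>The lamplighter group \<open>\<int>/2 \<wr> T\<close>\<close>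

text \<open>A configuration is a function on all lists that vanishes outside the group, so that
  equality of configurations is equality of functions on the group.\<close>

definition lamp_configs :: "nat \<Rightarrow> (nat list \<Rightarrow> bit) set" where
  "lamp_configs q =
    {\<eta>. {w. \<eta> w \<noteq> 0} \<subseteq> carrier (tree_group q) \<and> finite {w. \<eta> w \<noteq> 0}}"

definition translate :: "nat \<Rightarrow> nat list \<Rightarrow> (nat list \<Rightarrow> bit) \<Rightarrow> nat list \<Rightarrow> bit" where
  "translate q x \<eta> =
    (\<lambda>w. if w \<in> carrier (tree_group q)
         then \<eta> (inv\<^bsub>tree_group q\<^esub> x \<otimes>\<^bsub>tree_group q\<^esub> w) else 0)"

type_synonym lamplighter_elem = "(nat list \<Rightarrow> bit) \<times> nat list"

definition lamplighter_group :: "nat \<Rightarrow> lamplighter_elem monoid" where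
  "lamplighter_group q =
    \<lparr>carrier = lamp_configs q \<times> carrier (tree_group q),
     mult = (\<lambda>(\<eta>1, x) (\<eta>2, y).
       ((\<lambda>w. \<eta>1 w + translate q x \<eta>2 w), x \<otimes>\<^bsub>tree_group q\<^esub> y)),
     one = ((\<lambda>w. 0), [])\<rparr>"

definition switch_gen :: lamplighter_elem where
  "switch_gen = (indicator {[]}, [])"

definition move_gen :: "nat \<Rightarrow> lamplighter_elem" where
  "move_gen a = ((\<lambda>w. 0), [a])"

definition lamplighter_gens :: "nat \<Rightarrow> lamplighter_elem set" where
  "lamplighter_gens q = insert switch_gen (move_gen ` {..<q})"

section \<open>Word length in a Cayley graph\<close>

definition cayley_edges :: "('a, 'b) monoid_scheme \<Rightarrow> 'a set \<Rightarrow> ('a \<times> 'a) set" where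
  "cayley_edges G S =
    {(g, h). g \<in> carrier G \<and> h \<in> carrier G \<and> (\<exists>s\<in>S. h = g \<otimes>\<^bsub>G\<^esub> s \<or> g = h \<otimes>\<^bsub>G\<^esub> s)}"

definition word_length :: "('a, 'b) monoid_scheme \<Rightarrow> 'a set \<Rightarrow> 'a \<Rightarrow> nat" where
  "word_length G S g = (LEAST n. (g, \<one>\<^bsub>G\<^esub>) \<in> cayley_edges G S ^^ n)"

section \<open>The random walk\<close>

definition lamplighter_law :: "nat \<Rightarrow> real \<Rightarrow> lamplighter_elem \<Rightarrow> real" where
  "lamplighter_law q p g =
    (if g = switch_gen then p
     else if g \<in> move_gen ` {..<q} then (1 - p) / real q
     else 0)"

text \<open>The increments are indexed from 1; \<open>X 0\<close> is not used.\<close>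

primrec random_walk ::
  "('a, 'b) monoid_scheme \<Rightarrow> (nat \<Rightarrow> 'w \<Rightarrow> 'a) \<Rightarrow> nat \<Rightarrow> 'w \<Rightarrow> 'a" where
  "random_walk G X 0 \<omega> = \<one>\<^bsub>G\<^esub>"
| "random_walk G X (Suc n) \<omega> = random_walk G X n \<omega> \<otimes>\<^bsub>G\<^esub> X (Suc n) \<omega>"

definition is_rate_of_escape ::
  "'w measure \<Rightarrow> ('a, 'b) monoid_scheme \<Rightarrow> 'a set \<Rightarrow> (nat \<Rightarrow> 'w \<Rightarrow> 'a) \<Rightarrow> real \<Rightarrow> bool" where
  "is_rate_of_escape M G S Z l \<longleftrightarrow>
    (AE \<omega> in M. (\<lambda>n. real (word_length G S (Z n \<omega>)) / real n) \<longlonglongrightarrow> l)"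

section \<open>The constants in the bound\<close>

definition F_bar :: "nat \<Rightarrow> real \<Rightarrow> real" where
  "F_bar q p =
    (real q - sqrt ((real q)\<^sup>2 - 4 * (real q - 1) * (1 - p)\<^sup>2)) / (2 * (real q - 1) * (1 - p))"

definition nu3_hat :: "nat \<Rightarrow> real \<Rightarrow> real" where
  "nu3_hat q p =
    p * (real q - 2 + p) /
    (real q * (p * real q + real q - 2) * (1 - F_bar q p) * (1 - (1 - p) * F_bar q p))"

end

theory Submission
  imports Defs "HOL-Library.Sublist"
begin

text \<open>
  The shortest way to produce a state \<open>(\<eta>, x)\<close> from the identity is a tour in the tree that starts
  at \<open>[]\<close>, visits every lit lamp and stops at \<open>x\<close>; its length \<open>tour (\<eta>, x)\<close> is the number of lit
  lamps, plus the distance to \<open>x\<close>, plus twice the number of edges that lead to lit lamps but lie off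
  the geodesic from \<open>[]\<close> to \<open>x\<close>. So \<open>tour\<close> is a lower bound for the word length
  (\<open>tour_le_path_length\<close>), and it suffices that the mean of \<open>tour\<close> grows at least linearly with the
  claimed slope: word length divided by time is bounded, hence its mean tends to the rate of escape
  (\<open>rate_of_escape_ge\<close>).

  The increments are independent and identically distributed, so a further step may as well be put
  in front of the walk instead of at its end. The mean gain of \<open>tour\<close> in one step is therefore the
  mean change under left multiplication by a random generator. Left multiplication moves only the
  starting point of the tour: the switch toggles the lamp at the origin, and a letter \<open>a\<close> carries the
  origin across the edge between \<open>[]\<close> and \<open>[a]\<close>, so that the tour changes by \<open>1\<close> or \<open>-1\<close> according to
  the sides of this edge on which the end point and the lit lamps lie (\<open>tour_left_letter\<close>). Three
  long-run frequencies remain to be bounded.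

  The lamp at the origin is lit with frequency at most \<open>odd_prob\<close>, the probability that the walk
  switches a lamp an odd number of times after its first visit to it
  (\<open>occupation_lamp_at_origin\<close>).

  The event that the walker is outside branch \<open>a\<close> with a lit lamp inside has, up to exchanging the two
  ends of the edge, the probability of the event that the walker is in branch \<open>a\<close> with a lit lamp
  outside, times the probability \<open>F_one\<close> of crossing the edge at all
  (\<open>occupation_lamp_in_branch_le\<close>).

  The latter event has frequency at least \<open>nu3_hat\<close>: this is the probability that the first lamp that
  is ever switched lies outside the branch, is lit in the end, and the walk ends up in the branch. Up
  to the first switch the walk is killed at rate \<open>p\<close>, and \<open>F_bar\<close> is its probability to reach a
  neighbouring vertex; after the first switch, parity and end of the walk are independent
  (\<open>occupation_lamp_behind_ge\<close>).

  No limit of the walk is ever taken. The limiting probabilities enter as explicit solutions of the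
  equations that conditioning on the first step gives. Where such a solution is harmonic for the
  one-step operator \<open>walk_op\<close>, it is compared with the indicator of the event in question: the two
  differ by an amount that decays exponentially in the distance to some vertex, and by transience the
  expected sum of these errors over all times is finite (\<open>occupation_hit_le\<close>).
\<close>

section \<open>Reduced words\<close>

abbreviation reduced_words :: "nat \<Rightarrow> nat list set" where
  "reduced_words q \<equiv> carrier (tree_group q)"

lemma reduced_words_iff: "w \<in> reduced_words q \<longleftrightarrow> set w \<subseteq> {..<q} \<and> distinct_adj w"
  by (simp add: tree_group_def)

lemma tree_group_simps:
  "u \<otimes>\<^bsub>tree_group q\<^esub> v = foldr push_letter u v" "\<one>\<^bsub>tree_group q\<^esub> = []"
  by (simp_all add: tree_group_def)

lemma Nil_reduced [simp]: "[] \<in> reduced_words q"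
  by (simp add: reduced_words_iff)

lemma reduced_Cons:
  "a # w \<in> reduced_words q \<longleftrightarrow> a < q \<and> w \<in> reduced_words q \<and> (w = [] \<or> hd w \<noteq> a)"
  by (cases w) (auto simp: reduced_words_iff)

lemma push_letter_reduced:
  "w \<in> reduced_words q \<Longrightarrow> a < q \<Longrightarrow> push_letter a w \<in> reduced_words q"
  by (cases "(a, w)" rule: push_letter.cases) (auto simp: reduced_Cons)

lemma push_letter_involution: "w \<in> reduced_words q \<Longrightarrow> push_letter a (push_letter a w) = w"
proof (cases "(a, w)" rule: push_letter.cases)
  case (2 c b v)
  then show "w \<in> reduced_words q \<Longrightarrow> push_letter a (push_letter a w) = w"
    by (cases v) (auto simp: reduced_Cons)
qed auto

lemma push_letter_eq_iff:
  "v \<in> reduced_words q \<Longrightarrow> w \<in> reduced_words q \<Longrightarrow> push_letter a v = w \<longleftrightarrow> v = push_letter a w"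
  using push_letter_involution by metis

lemma push_letter_foldr:
  assumes "w \<in> reduced_words q" "v \<in> reduced_words q"
  shows "foldr push_letter (push_letter a v) w = push_letter a (foldr push_letter v w)"
proof -
  have closed: "foldr push_letter u w \<in> reduced_words q" if "u \<in> reduced_words q" for u
    using that assms(1) by (induction u) (auto simp: reduced_Cons push_letter_reduced)
  show ?thesis
    using assms(2) push_letter_involution[OF closed]
    by (cases "(a, v)" rule: push_letter.cases) (auto simp: reduced_Cons)
qed

lemma tree_group_is_group: "group (tree_group q)"
proof (rule groupI)
  have closed: "foldr push_letter u w \<in> reduced_words q"
    if "u \<in> reduced_words q" "w \<in> reduced_words q" for u w
    using that by (induction u) (auto simp: reduced_Cons push_letter_reduced)
  fix u v w assume u: "u \<in> reduced_words q" and v: "v \<in> reduced_words q"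
    and w: "w \<in> reduced_words q"
  show "u \<otimes>\<^bsub>tree_group q\<^esub> v \<in> reduced_words q"
    using u v closed by (simp add: tree_group_simps)
  show "u \<otimes>\<^bsub>tree_group q\<^esub> v \<otimes>\<^bsub>tree_group q\<^esub> w
        = u \<otimes>\<^bsub>tree_group q\<^esub> (v \<otimes>\<^bsub>tree_group q\<^esub> w)"
    using u unfolding tree_group_simps
    by (induction u) (auto simp: reduced_Cons push_letter_foldr[OF w] closed v)
  show "\<exists>y\<in>reduced_words q. y \<otimes>\<^bsub>tree_group q\<^esub> u = \<one>\<^bsub>tree_group q\<^esub>"
  proof
    show "rev u \<in> reduced_words q" using u by (simp add: reduced_words_iff)
    have "foldr push_letter (rev u) u = []"
      using u by (induction u) (auto simp: reduced_Cons)
    then show "rev u \<otimes>\<^bsub>tree_group q\<^esub> u = \<one>\<^bsub>tree_group q\<^esub>"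
      by (simp add: tree_group_simps)
  qed
qed (auto simp: tree_group_simps)

lemma last_less: "x \<in> reduced_words q \<Longrightarrow> x \<noteq> [] \<Longrightarrow> last x < q"
  using last_in_set[of x] by (auto simp: reduced_words_iff subset_iff)

lemma inv_mult_eq_Nil:
  assumes "w \<in> reduced_words q" "y \<in> reduced_words q"
  shows "inv\<^bsub>tree_group q\<^esub> w \<otimes>\<^bsub>tree_group q\<^esub> y = [] \<longleftrightarrow> y = w"
proof -
  interpret group "tree_group q" by (rule tree_group_is_group)
  have "inv\<^bsub>tree_group q\<^esub> w \<otimes>\<^bsub>tree_group q\<^esub> y = \<one>\<^bsub>tree_group q\<^esub> \<longleftrightarrow> y = w"
    using assms by (metis inv_closed inv_equality inv_inv l_inv)
  then show ?thesis by (simp add: tree_group_simps)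
qed

definition neighbour :: "nat list \<Rightarrow> nat \<Rightarrow> nat list" where
  "neighbour x b = foldr push_letter x [b]"

lemma neighbour_eq:
  assumes "x \<in> reduced_words q"
  shows "neighbour x b = (if x \<noteq> [] \<and> last x = b then butlast x else x @ [b])"
  using assms
proof (induction x)
  case Nil
  then show ?case by (simp add: neighbour_def)
next
  case (Cons a x)
  then have IH: "neighbour x b = (if x \<noteq> [] \<and> last x = b then butlast x else x @ [b])"
    and hd: "x \<noteq> [] \<Longrightarrow> hd x \<noteq> a" by (auto simp: reduced_Cons)
  have "neighbour (a # x) b = push_letter a (neighbour x b)" by (simp add: neighbour_def)
  also have "\<dots> = (if last (a # x) = b then butlast (a # x) else (a # x) @ [b])"
  proof (cases x)
    case (Cons c y)
    then show ?thesis using hd by (cases y) (use IH in auto)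
  qed (use IH in simp)
  finally show ?case by simp
qed

lemma neighbour_reduced:
  assumes "x \<in> reduced_words q" "b < q"
  shows "neighbour x b \<in> reduced_words q"
proof (cases x rule: rev_cases)
  case (snoc y c)
  then show ?thesis using assms neighbour_eq[OF assms(1), of b]
    by (auto simp: reduced_words_iff distinct_adj_append_iff)
qed (use assms in \<open>auto simp: neighbour_def reduced_Cons\<close>)

text \<open>This is associativity; it makes the walk invariant under left translations.\<close>

lemma neighbour_push_letter:
  assumes "x \<in> reduced_words q" "b < q"
  shows "neighbour (push_letter a x) b = push_letter a (neighbour x b)"
  unfolding neighbour_def by (rule push_letter_foldr) (use assms in \<open>auto simp: reduced_Cons\<close>)

lemma sum_neighbours:
  fixes f :: "nat list \<Rightarrow> real"
  assumes "x \<in> reduced_words q" "x \<noteq> []"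
  shows "(\<Sum>b<q. f (neighbour x b)) = f (butlast x) + (\<Sum>b\<in>{..<q} - {last x}. f (x @ [b]))"
proof -
  have "last x < q" using assms last_less by blast
  then have "(\<Sum>b<q. f (neighbour x b))
      = f (neighbour x (last x)) + (\<Sum>b\<in>{..<q} - {last x}. f (neighbour x b))"
    by (intro sum.remove) auto
  also have "(\<Sum>b\<in>{..<q} - {last x}. f (neighbour x b)) = (\<Sum>b\<in>{..<q} - {last x}. f (x @ [b]))"
    by (intro sum.cong) (auto simp: neighbour_eq[OF assms(1)])
  finally show ?thesis using assms by (simp add: neighbour_eq)
qed

lemma sum_neighbours_length:
  assumes "x \<in> reduced_words q"
  shows "(\<Sum>b<q. (f (length (neighbour x b)) :: real)) =
    (if x = [] then real q * f 1 else f (length x - 1) + (real q - 1) * f (length x + 1))"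
proof (cases "x = []")
  case False
  then have "last x < q" using assms last_less by blast
  then show ?thesis using False sum_neighbours[OF assms, of "\<lambda>x. f (length x)"]
    by (simp add: of_nat_diff)
qed (simp add: neighbour_def)

abbreviation in_branch :: "nat \<Rightarrow> nat list \<Rightarrow> bool" where
  "in_branch a x \<equiv> x \<noteq> [] \<and> hd x = a"

text \<open>The edge between \<open>[]\<close> and \<open>[a]\<close> cuts the tree in two halves. Both arguments are evaluated at
  the distance of \<open>x\<close> to the end of the edge on its own side, so that the two halves play symmetric
  roles.\<close>

definition by_side :: "nat \<Rightarrow> (nat \<Rightarrow> real) \<Rightarrow> (nat \<Rightarrow> real) \<Rightarrow> nat list \<Rightarrow> real" where
  "by_side a fin fout x = (if in_branch a x then fin (length x - 1) else fout (length x))"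

lemma sum_neighbours_by_side:
  assumes x: "x \<in> reduced_words q" and a: "a < q"
  shows "(\<Sum>b<q. by_side a fin fout (neighbour x b)) =
    (if in_branch a x
     then (if length x = 1 then fout 0 else fin (length x - 2)) + (real q - 1) * fin (length x)
     else (if x = [] then fin 0 else fout (length x - 1)) + (real q - 1) * fout (length x + 1))"
proof (cases "x = []")
  case True
  have "(\<Sum>b<q. by_side a fin fout [b]) = fin 0 + (\<Sum>b\<in>{..<q} - {a}. by_side a fin fout [b])"
    using a by (subst sum.remove[of _ a]) (auto simp: by_side_def)
  also have "(\<Sum>b\<in>{..<q} - {a}. by_side a fin fout [b]) = (\<Sum>b\<in>{..<q} - {a}. fout 1)"
    by (intro sum.cong) (auto simp: by_side_def)
  finally show ?thesis using True a by (simp add: neighbour_def of_nat_diff)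
next
  case False
  then have l: "last x < q" using x last_less by blast
  have "(\<Sum>b\<in>{..<q} - {last x}. by_side a fin fout (x @ [b]))
      = (real q - 1) * (if hd x = a then fin (length x) else fout (length x + 1))"
    using False l by (simp add: by_side_def of_nat_diff)
  moreover have "by_side a fin fout (butlast x) = (if hd x = a
     then (if length x = 1 then fout 0 else fin (length x - 2)) else fout (length x - 1))"
    using False by (cases x) (auto simp: by_side_def neq_Nil_conv numeral_2_eq_2 split: if_splits)
  ultimately show ?thesis
    using False sum_neighbours[OF x False, of "by_side a fin fout"] by simp
qed

section \<open>Expectations along the walk\<close>

lemma states_iff:
  "(\<eta>, x) \<in> carrier (lamplighter_group q) \<longleftrightarrow> \<eta> \<in> lamp_configs q \<and> x \<in> reduced_words q"
  by (simp add: lamplighter_group_def)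

lemma lamp_configs_zero [simp]: "(\<lambda>w. 0) \<in> lamp_configs q"
  by (simp add: lamp_configs_def)

lemma lamp_configs_upd:
  assumes "\<eta> \<in> lamp_configs q" "x \<in> reduced_words q"
  shows "\<eta>(x := c) \<in> lamp_configs q"
proof -
  have "{w. (\<eta>(x := c)) w \<noteq> 0} \<subseteq> insert x {w. \<eta> w \<noteq> 0}" by auto
  moreover have "finite (insert x {w. \<eta> w \<noteq> 0})" "insert x {w. \<eta> w \<noteq> 0} \<subseteq> reduced_words q"
    using assms by (auto simp: lamp_configs_def)
  ultimately show ?thesis
    unfolding lamp_configs_def mem_Collect_eq by (meson finite_subset subset_trans)
qed

text \<open>Left multiplication by the generator \<open>move_gen a\<close>. The inverse that translates the configuration is
  again \<open>a\<close>, as letters are involutions; \<open>switch_origin\<close> below is left multiplication by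
  \<open>switch_gen\<close>.\<close>

definition left_letter :: "nat \<Rightarrow> nat \<Rightarrow> lamplighter_elem \<Rightarrow> lamplighter_elem" where
  "left_letter q a = (\<lambda>(\<eta>, x).
     (\<lambda>w. if w \<in> reduced_words q then \<eta> (push_letter a w) else 0, push_letter a x))"

definition switch_origin :: "lamplighter_elem \<Rightarrow> lamplighter_elem" where
  "switch_origin = (\<lambda>(\<eta>, x). (\<eta>([] := \<eta> [] + 1), x))"

lemma supp_left_letter:
  assumes "\<eta> \<in> lamp_configs q" "a < q"
  shows "{w. fst (left_letter q a (\<eta>, x)) w \<noteq> 0} = push_letter a ` {w. \<eta> w \<noteq> 0}"
proof (rule Set.set_eqI)
  fix w
  have red: "v \<in> reduced_words q" if "\<eta> v \<noteq> 0" for v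
    using assms(1) that by (auto simp: lamp_configs_def)
  show "w \<in> {w. fst (left_letter q a (\<eta>, x)) w \<noteq> 0} \<longleftrightarrow> w \<in> push_letter a ` {w. \<eta> w \<noteq> 0}"
    using red push_letter_reduced[of _ q a] push_letter_involution[of _ q a] assms(2)
    by (auto simp: left_letter_def image_iff)
qed

lemma left_letter_states:
  assumes "g \<in> carrier (lamplighter_group q)" "a < q"
  shows "left_letter q a g \<in> carrier (lamplighter_group q)"
proof (cases g)
  case (Pair \<eta> x)
  then have \<eta>: "\<eta> \<in> lamp_configs q" and x: "x \<in> reduced_words q"
    using assms by (auto simp: states_iff)
  have "fst (left_letter q a (\<eta>, x)) \<in> lamp_configs q"
    using \<eta> assms(2) push_letter_reduced unfolding lamp_configs_def mem_Collect_eq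
      supp_left_letter[OF \<eta> assms(2)] by auto
  then show ?thesis
    using Pair x assms(2) push_letter_reduced
    by (auto simp: lamplighter_group_def left_letter_def)
qed

locale lamplighter_walk =
  fixes q :: nat and p :: real
  assumes q_ge: "q \<ge> 3" and p_pos: "0 < p" and p_less: "p < 1"
begin

abbreviation states :: "lamplighter_elem set" where
  "states \<equiv> carrier (lamplighter_group q)"

text \<open>The Markov operator of the walk: the mean of \<open>f\<close> after one step. Its iterates are the means of \<open>f\<close>
  along the walk, and \<open>occupation\<close> is the expected sum of \<open>f\<close> over the first \<open>N\<close> times.\<close>

definition walk_op :: "(lamplighter_elem \<Rightarrow> real) \<Rightarrow> lamplighter_elem \<Rightarrow> real" where
  "walk_op f = (\<lambda>(\<eta>, x). p * f (\<eta>(x := \<eta> x + 1), x)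
                 + (1 - p) / real q * (\<Sum>b<q. f (\<eta>, neighbour x b)))"

definition occupation :: "nat \<Rightarrow> (lamplighter_elem \<Rightarrow> real) \<Rightarrow> lamplighter_elem \<Rightarrow> real" where
  "occupation N f g = (\<Sum>n<N. (walk_op ^^ n) f g)"

lemma walk_op_apply:
  "walk_op f (\<eta>, x) = p * f (\<eta>(x := \<eta> x + 1), x)
     + (1 - p) / real q * (\<Sum>b<q. f (\<eta>, neighbour x b))"
  by (simp add: walk_op_def)

lemma walk_op_linear:
  "walk_op (\<lambda>g. u g + v g) = (\<lambda>g. walk_op u g + walk_op v g)"
  "walk_op (\<lambda>g. c * u g) = (\<lambda>g. c * walk_op u g)"
  "walk_op (\<lambda>g. 0) = (\<lambda>g. 0)"
  by (auto simp: walk_op_def fun_eq_iff sum.distrib sum_distrib_left algebra_simps)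

lemma walk_op_sum: "walk_op (\<lambda>g. \<Sum>i\<in>I. u i g) = (\<lambda>g. \<Sum>i\<in>I. walk_op (u i) g)"
  by (induction I rule: infinite_finite_induct) (simp_all add: walk_op_linear)

lemma walk_op_const: "walk_op (\<lambda>g. c) = (\<lambda>g. c)"
  using q_ge by (auto simp: walk_op_def fun_eq_iff field_simps)

lemma walk_op_mono:
  assumes "g \<in> states" "\<And>h. h \<in> states \<Longrightarrow> u h \<le> v h"
  shows "walk_op u g \<le> walk_op v g"
proof (cases g)
  case (Pair \<eta> x)
  then show ?thesis
    using assms p_pos p_less unfolding walk_op_def
    by (auto intro!: add_mono mult_left_mono sum_mono divide_right_mono
             simp: states_iff lamp_configs_upd neighbour_reduced)
qed

lemma walk_op_cong:
  assumes "g \<in> states" "\<And>h. h \<in> states \<Longrightarrow> u h = v h"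
  shows "walk_op u g = walk_op v g"
  using walk_op_mono[OF assms(1), of u v] walk_op_mono[OF assms(1), of v u] assms(2) by force

lemma iterate_linear:
  "(walk_op ^^ n) (\<lambda>g. u g + v g) = (\<lambda>g. (walk_op ^^ n) u g + (walk_op ^^ n) v g)"
  "(walk_op ^^ n) (\<lambda>g. c * u g) = (\<lambda>g. c * (walk_op ^^ n) u g)"
  "(walk_op ^^ n) (\<lambda>g. c) = (\<lambda>g. c)"
  by (induction n) (simp_all add: walk_op_linear walk_op_const)

lemma iterate_sum:
  "(walk_op ^^ n) (\<lambda>g. \<Sum>i\<in>I. u i g) = (\<lambda>g. \<Sum>i\<in>I. (walk_op ^^ n) (u i) g)"
  by (induction n) (simp_all add: walk_op_sum)

lemma iterate_mono:
  assumes "g \<in> states" "\<And>h. h \<in> states \<Longrightarrow> u h \<le> v h"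
  shows "(walk_op ^^ n) u g \<le> (walk_op ^^ n) v g"
  using assms by (induction n arbitrary: g) (auto intro: walk_op_mono)

lemma occupation_0 [simp]: "occupation 0 f g = 0"
  by (simp add: occupation_def)

lemma occupation_Suc: "occupation (Suc N) f g = f g + walk_op (occupation N f) g"
proof -
  have "walk_op (occupation N f) = (\<lambda>g. \<Sum>n<N. (walk_op ^^ Suc n) f g)"
    unfolding occupation_def[abs_def] by (simp add: walk_op_sum)
  then show ?thesis
    by (simp add: occupation_def sum.lessThan_Suc_shift del: sum.lessThan_Suc)
qed

lemma occupation_add: "occupation N (\<lambda>g. u g + v g) g = occupation N u g + occupation N v g"
  by (simp add: occupation_def iterate_linear sum.distrib)

lemma occupation_cmult: "occupation N (\<lambda>g. c * u g) g = c * occupation N u g"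
  by (simp add: occupation_def iterate_linear sum_distrib_left)

lemma occupation_const: "occupation N (\<lambda>g. c) g = real N * c"
  by (simp add: occupation_def iterate_linear)

lemma occupation_sum:
  "occupation N (\<lambda>g. \<Sum>i\<in>I. u i g) g = (\<Sum>i\<in>I. occupation N (u i) g)"
  unfolding occupation_def iterate_sum by (rule sum.swap)

lemma occupation_mono:
  assumes "g \<in> states" "\<And>h. h \<in> states \<Longrightarrow> u h \<le> v h"
  shows "occupation N u g \<le> occupation N v g"
  unfolding occupation_def by (intro sum_mono iterate_mono assms)

lemma occupation_nonneg:
  assumes "g \<in> states" "\<And>h. h \<in> states \<Longrightarrow> 0 \<le> u h"
  shows "0 \<le> occupation N u g"
  using occupation_mono[of g "\<lambda>_. 0" u N] assms by (simp add: occupation_const)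

lemma occupation_mono_time:
  assumes "g \<in> states" "\<And>h. h \<in> states \<Longrightarrow> 0 \<le> u h"
  shows "occupation N u g \<le> occupation (Suc N) u g"
  using iterate_mono[of g "\<lambda>_. 0" u N] assms by (simp add: occupation_def iterate_linear)

lemma occupation_harmonic:
  assumes "g \<in> states" "\<And>h. h \<in> states \<Longrightarrow> walk_op u h = u h"
  shows "occupation N u g = real N * u g"
proof -
  have "(walk_op ^^ n) u h = u h" if "h \<in> states" for n h
    using that
  proof (induction n arbitrary: h)
    case (Suc n)
    then show ?case using walk_op_cong[of h "(walk_op ^^ n) u" u] assms(2) by simp
  qed simp
  then show ?thesis using assms(1) by (simp add: occupation_def)
qed

text \<open>A non-negative \<open>u\<close> with \<open>f + walk_op u \<le> u\<close> is a potential that pays for all future values of \<open>f\<close>.\<close>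

lemma occupation_le:
  assumes "g \<in> states" "\<And>h. h \<in> states \<Longrightarrow> 0 \<le> u h"
    and "\<And>h. h \<in> states \<Longrightarrow> f h + walk_op u h \<le> u h"
  shows "occupation N f g \<le> u g"
  using assms(1)
proof (induction N arbitrary: g)
  case (Suc N)
  have "occupation (Suc N) f g \<le> f g + walk_op u g"
    using walk_op_mono[OF Suc.prems Suc.IH] by (simp add: occupation_Suc)
  then show ?case using assms(3)[OF Suc.prems] by simp
qed (use assms(2) in simp)

text \<open>A map that commutes with the steps of the walk can be applied to the initial state instead of the
  final one. The steps act on the right, so left multiplications are of this kind.\<close>

lemma iterate_commute:
  assumes "\<And>f h. h \<in> states \<Longrightarrow> walk_op (f \<circ> L) h = walk_op f (L h)" and "g \<in> states"
  shows "(walk_op ^^ n) f (L g) = (walk_op ^^ n) (f \<circ> L) g"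
  using assms(2)
proof (induction n arbitrary: g)
  case (Suc n)
  have "walk_op ((walk_op ^^ n) f) (L g) = walk_op ((walk_op ^^ n) f \<circ> L) g"
    using assms(1)[OF Suc.prems] by simp
  also have "\<dots> = walk_op ((walk_op ^^ n) (f \<circ> L)) g"
    by (rule walk_op_cong[OF Suc.prems]) (metis Suc.IH comp_apply)
  finally show ?case by (simp add: comp_def)
qed simp

lemma walk_op_left_letter:
  assumes g: "g \<in> states" and a: "a < q"
  shows "walk_op (f \<circ> left_letter q a) g = walk_op f (left_letter q a g)"
proof (cases g)
  case (Pair \<eta> x)
  then have x: "x \<in> reduced_words q" using g by (simp add: states_iff)
  define \<zeta> where "\<zeta> = (\<lambda>w. if w \<in> reduced_words q then \<eta> (push_letter a w) else 0)"
  have sh: "left_letter q a (\<eta>, y) = (\<zeta>, push_letter a y)" for y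
    by (simp add: left_letter_def \<zeta>_def)
  have "left_letter q a (\<eta>(x := \<eta> x + 1), x)
      = (\<zeta>(push_letter a x := \<zeta> (push_letter a x) + 1), push_letter a x)"
    using x a push_letter_reduced push_letter_involution push_letter_eq_iff
    by (auto simp: left_letter_def \<zeta>_def fun_eq_iff)
  then show ?thesis
    using x a Pair neighbour_push_letter by (simp add: walk_op_def sh)
qed

lemma walk_op_switch_origin: "walk_op (f \<circ> switch_origin) g = walk_op f (switch_origin g)"
  by (cases g) (auto simp: walk_op_def switch_origin_def fun_upd_twist)

lemma iterate_left_letter:
  assumes "g \<in> states" "a < q"
  shows "(walk_op ^^ n) f (left_letter q a g) = (walk_op ^^ n) (f \<circ> left_letter q a) g"
  by (rule iterate_commute[OF walk_op_left_letter]) (use assms in auto)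

lemmas iterate_switch_origin = iterate_commute[OF walk_op_switch_origin]

text \<open>Lamps outside the set \<open>R\<close> that \<open>f\<close> looks at have no influence on where the walker goes.\<close>

lemma iterate_local:
  assumes "\<And>\<eta> \<zeta> x. \<forall>w\<in>R. \<eta> w = \<zeta> w \<Longrightarrow> f (\<eta>, x) = f (\<zeta>, x)"
    and "\<forall>w\<in>R. \<eta> w = \<zeta> w"
  shows "(walk_op ^^ n) f (\<eta>, x) = (walk_op ^^ n) f (\<zeta>, x)"
  using assms(2)
proof (induction n arbitrary: \<eta> \<zeta> x)
  case 0
  then show ?case using assms(1) by simp
next
  case (Suc n)
  then have "(walk_op ^^ n) f (\<eta>(x := \<eta> x + 1), x) = (walk_op ^^ n) f (\<zeta>(x := \<zeta> x + 1), x)"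
    by (cases "x \<in> R") (auto intro!: Suc.IH)
  moreover have "(walk_op ^^ n) f (\<eta>, y) = (walk_op ^^ n) f (\<zeta>, y)" for y
    using Suc by blast
  ultimately show ?case by (simp only: funpow.simps o_apply walk_op_apply)
qed

section \<open>Hitting probabilities and transience\<close>

definition distance :: "nat list \<Rightarrow> nat list \<Rightarrow> nat" where
  "distance w y = length (inv\<^bsub>tree_group q\<^esub> w \<otimes>\<^bsub>tree_group q\<^esub> y)"

lemma distance_Nil: "distance [] y = length y"
proof -
  interpret group "tree_group q" by (rule tree_group_is_group)
  show ?thesis using inv_one by (simp add: distance_def tree_group_simps)
qed

lemma distance_eq_0:
  "w \<in> reduced_words q \<Longrightarrow> y \<in> reduced_words q \<Longrightarrow> distance w y = 0 \<longleftrightarrow> y = w"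
  by (simp add: distance_def inv_mult_eq_Nil)

lemma sum_neighbours_distance:
  assumes w: "w \<in> reduced_words q" and y: "y \<in> reduced_words q"
  shows "(\<Sum>b<q. (f (distance w (neighbour y b)) :: real)) =
    (if y = w then real q * f 1 else f (distance w y - 1) + (real q - 1) * f (distance w y + 1))"
proof -
  interpret group "tree_group q" by (rule tree_group_is_group)
  let ?z = "inv\<^bsub>tree_group q\<^esub> w \<otimes>\<^bsub>tree_group q\<^esub> y"
  have z: "?z \<in> reduced_words q" using assms by simp
  have "distance w (neighbour y b) = length (neighbour ?z b)" if "b < q" for b
  proof -
    have "[b] \<in> reduced_words q" using that by (simp add: reduced_Cons)
    then have "inv\<^bsub>tree_group q\<^esub> w \<otimes>\<^bsub>tree_group q\<^esub> (y \<otimes>\<^bsub>tree_group q\<^esub> [b])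
        = ?z \<otimes>\<^bsub>tree_group q\<^esub> [b]" using w y by (simp add: m_assoc)
    then show ?thesis by (simp add: distance_def neighbour_def tree_group_simps)
  qed
  then have "(\<Sum>b<q. f (distance w (neighbour y b))) = (\<Sum>b<q. f (length (neighbour ?z b)))"
    by simp
  then show ?thesis
    using sum_neighbours_length[OF z, of f] distance_eq_0[OF w y] by (simp add: distance_def)
qed

text \<open>The probability that the walk ever reaches a given neighbouring vertex; hence \<open>hit w y\<close> is the
  probability that it ever reaches \<open>w\<close> from \<open>y\<close>. These probabilistic meanings are only motivation, what
  counts is that \<open>hit w\<close> is harmonic off \<open>w\<close>.\<close>

definition F_one :: real where
  "F_one = 1 / (real q - 1)"

lemma F_one: "real q * F_one = 1 + F_one" "0 < F_one" "F_one \<le> 1 / 2"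
  using q_ge by (auto simp: F_one_def field_simps)

lemma F_one_mult:
  "(real q - 1) * (F_one * c) = c" "real q * (F_one * c) = c + F_one * c"
  using q_ge by (simp_all add: F_one_def field_simps)

definition hit :: "nat list \<Rightarrow> nat list \<Rightarrow> real" where
  "hit w y = F_one ^ distance w y"

lemma hit_bounds: "0 \<le> hit w y" "hit w y \<le> 1"
  using F_one by (auto simp: hit_def intro!: power_le_one)

lemma hit_self: "w \<in> reduced_words q \<Longrightarrow> hit w w = 1"
  using distance_eq_0[of w w] by (simp add: hit_def)

lemma sum_neighbours_hit:
  assumes "w \<in> reduced_words q" "y \<in> reduced_words q"
  shows "(\<Sum>b<q. hit w (neighbour y b)) =
    real q * (if y = w then F_one else hit w y)"
proof (cases "y = w")
  case False
  then obtain d where "distance w y = Suc d"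
    using distance_eq_0[OF assms] not0_implies_Suc by blast
  moreover have "F_one ^ d + (real q - 1) * (F_one * (F_one * F_one ^ d))
      = real q * (F_one * F_one ^ d)"
    unfolding F_one_mult(1) using F_one_mult(1)[of "F_one ^ d"] by (simp add: algebra_simps)
  ultimately show ?thesis
    using False sum_neighbours_distance[OF assms, of "\<lambda>d. F_one ^ d"] by (simp add: hit_def)
qed (use sum_neighbours_distance[OF assms, of "\<lambda>d. F_one ^ d"] in \<open>simp add: hit_def\<close>)

text \<open>The speed of the walker in the tree.\<close>

definition drift :: real where
  "drift = (1 - p) * (real q - 2) / real q"

lemma drift_pos: "drift > 0"
  using q_ge p_less by (simp add: drift_def)

text \<open>Transience. Off \<open>w\<close> the function \<open>hit w\<close> is harmonic; multiplied by the distance \<open>d\<close> to \<open>w\<close> it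
  loses exactly \<open>drift * hit w\<close> in each step, because weighting by \<open>hit w\<close> makes the walker drift
  towards \<open>w\<close>. Adding \<open>2\<close> to \<open>d\<close> makes the loss at least that large at \<open>w\<close>
  itself, where the walker can only move away.\<close>

lemma occupation_hit_le:
  assumes w: "w \<in> reduced_words q" and g: "g \<in> states"
  shows "occupation N (\<lambda>(\<eta>, y). hit w y) g \<le> 2 / drift"
proof -
  define \<phi> where "\<phi> y = (real (distance w y) + 2) * hit w y" for y
  have step: "(\<Sum>b<q. \<phi> (neighbour y b)) \<le> real q * \<phi> y - (real q - 2) * hit w y"
    if y: "y \<in> reduced_words q" for y
  proof (cases "y = w")
    case True
    have "1 * F_one \<le> (real q - 2) * F_one" by (intro mult_right_mono) (use q_ge F_one in auto)
    then have "3 * (real q * F_one) \<le> real q + 2" using q_ge F_one by (simp add: algebra_simps)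
    then show ?thesis
      using sum_neighbours_distance[OF w y, of "\<lambda>d. (real d + 2) * F_one ^ d"]
        True distance_eq_0[OF w w] hit_self[OF w]
      by (simp add: \<phi>_def hit_def algebra_simps)
  next
    case False
    then obtain d where d: "distance w y = Suc d"
      using distance_eq_0[OF w y] not0_implies_Suc by blast
    have "(real d + 2) * F_one ^ d + (real q - 1) * (F_one * ((real d + 4) * (F_one * F_one ^ d)))
        = real q * ((real d + 3) * (F_one * F_one ^ d)) - (real q - 2) * (F_one * F_one ^ d)"
      unfolding F_one_mult(1) using F_one_mult(1)[of "F_one ^ d"] F_one_mult(1)[of "real d * F_one ^ d"]
      by (simp add: algebra_simps)
    then show ?thesis
      using sum_neighbours_distance[OF w y, of "\<lambda>d. (real d + 2) * F_one ^ d"] False d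
      by (simp add: \<phi>_def hit_def algebra_simps)
  qed
  have "occupation N (\<lambda>(\<eta>, y). hit w y) g \<le> (\<lambda>(\<eta>, y). \<phi> y / drift) g"
  proof (rule occupation_le[OF g])
    fix h assume "h \<in> states"
    then obtain \<eta> y where h: "h = (\<eta>, y)" and y: "y \<in> reduced_words q"
      by (cases h) (simp add: states_iff)
    show "0 \<le> (\<lambda>(\<eta>, y). \<phi> y / drift) h"
      using hit_bounds drift_pos by (simp add: h \<phi>_def)
    define A where "A = p * \<phi> y + (1 - p) / real q * (\<Sum>b<q. \<phi> (neighbour y b))"
    have "(1 - p) / real q * (\<Sum>b<q. \<phi> (neighbour y b))
        \<le> (1 - p) / real q * (real q * \<phi> y - (real q - 2) * hit w y)"
      by (rule mult_left_mono[OF step[OF y]]) (use p_less in simp)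
    also have "\<dots> = (1 - p) * \<phi> y - drift * hit w y"
      using q_ge by (simp add: drift_def field_simps)
    finally have "drift * hit w y + A \<le> \<phi> y" by (simp add: A_def algebra_simps)
    moreover have "walk_op (\<lambda>(\<eta>, y). \<phi> y / drift) (\<eta>, y) = A / drift"
      by (simp add: A_def walk_op_apply add_divide_distrib flip: sum_divide_distrib)
    ultimately show "(\<lambda>(\<eta>, y). hit w y) h + walk_op (\<lambda>(\<eta>, y). \<phi> y / drift) h
        \<le> (\<lambda>(\<eta>, y). \<phi> y / drift) h"
      using drift_pos by (simp add: h field_simps)
  qed
  also have "\<dots> \<le> 2 / drift"
  proof -
    have "real d + 2 \<le> 2 * 2 ^ d" for d by (induction d) auto
    then have "\<phi> y \<le> 2 * 2 ^ distance w y * (1 / 2) ^ distance w y" for y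
      unfolding \<phi>_def hit_def using F_one by (intro mult_mono power_mono) auto
    then have "\<phi> y \<le> 2" for y by (simp add: power_one_over)
    then show ?thesis using drift_pos by (simp add: split_beta divide_right_mono)
  qed
  finally show ?thesis .
qed

section \<open>The final state of a lamp\<close>

text \<open>The probability that the lamp at the position of the walker will be switched an odd number of times
  from now on. At the lamp the walker either switches, or moves away and comes back with probability
  \<open>F_one\<close>; \<open>odd_prob_eq\<close> is the resulting equation.\<close>

definition odd_prob :: real where
  "odd_prob = p * (real q - 1) / (p * real q + real q - 2)"

lemma denom_pos: "p * real q + real q - 2 > 0"
  using q_ge p_pos by (simp add: add_pos_pos add_diff_eq[symmetric] del: add_diff_eq)

lemma odd_prob_eq: "p * (1 - odd_prob) + (1 - p) * (odd_prob * F_one) = odd_prob"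
proof -
  have "odd_prob * F_one = p / (p * real q + real q - 2)"
    using q_ge by (simp add: odd_prob_def F_one_def)
  then show ?thesis
    unfolding \<open>odd_prob * F_one = _\<close>
    using denom_pos by (simp add: odd_prob_def divide_simps) (simp add: algebra_simps)
qed

lemma odd_prob_bounds: "0 \<le> odd_prob" "odd_prob \<le> 1"
proof -
  have "p * (real q - 1) \<le> p * real q + real q - 2"
    using q_ge p_pos by (simp add: algebra_simps)
  then show "0 \<le> odd_prob" "odd_prob \<le> 1"
    using denom_pos p_pos q_ge by (simp_all add: odd_prob_def)
qed

definition tree_harmonic :: "(nat list \<Rightarrow> real) \<Rightarrow> bool" where
  "tree_harmonic h \<longleftrightarrow>
     (\<forall>y\<in>reduced_words q. (\<Sum>b<q. h (neighbour y b)) = real q * h y)"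

text \<open>Let \<open>h\<close> be the probability of some event about the end of the walker. Then \<open>lamp_value h w\<close> is the
  probability that this event occurs and the lamp at \<open>w\<close> is lit in the end: on the way through \<open>w\<close>, which
  is hit with probability \<open>hit w y\<close>, the state of the lamp changes with probability \<open>odd_prob\<close>,
  independently of where the walker goes after its last visit to \<open>w\<close>.\<close>

definition lamp_value :: "(nat list \<Rightarrow> real) \<Rightarrow> nat list \<Rightarrow> lamplighter_elem \<Rightarrow> real" where
  "lamp_value h w = (\<lambda>(\<eta>, y).
     if \<eta> w = 0 then odd_prob * h w * hit w y else h y - odd_prob * h w * hit w y)"

lemma walk_op_lamp_value:
  assumes h: "tree_harmonic h" and w: "w \<in> reduced_words q" and g: "g \<in> states"
  shows "walk_op (lamp_value h w) g = lamp_value h w g"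
proof (cases g)
  case (Pair \<eta> y)
  then have y: "y \<in> reduced_words q" using g by (simp add: states_iff)
  define c where "c = odd_prob * h w"
  have hy: "(1 - p) / real q * (\<Sum>b<q. h (neighbour y b)) = (1 - p) * h y"
    using h y q_ge by (simp add: tree_harmonic_def)
  have hity: "(1 - p) / real q * (\<Sum>b<q. c * hit w (neighbour y b))
      = (1 - p) * (c * (if y = w then F_one else hit w y))"
    using sum_neighbours_hit[OF w y] q_ge by (simp flip: sum_distrib_left)
  have lv: "lamp_value h w (\<zeta>, z) = (if \<zeta> w = 0 then c * hit w z else h z - c * hit w z)" for \<zeta> z
    by (simp add: lamp_value_def c_def)
  have avg: "(1 - p) / real q * (\<Sum>b<q. lamp_value h w (\<eta>, neighbour y b))
      = (if \<eta> w = 0 then (1 - p) * (c * (if y = w then F_one else hit w y))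
         else (1 - p) * h y - (1 - p) * (c * (if y = w then F_one else hit w y)))"
  proof (cases "\<eta> w = 0")
    case True
    then show ?thesis by (simp only: lv hity if_True refl)
  next
    case False
    then show ?thesis by (simp only: lv hy hity if_False refl sum_subtractf right_diff_distrib)
  qed
  show ?thesis
  proof (cases "y = w")
    case True
    have eq: "p * (h w - c) + (1 - p) * (c * F_one) = c"
      using arg_cong[OF odd_prob_eq, of "\<lambda>t. t * h w"] by (simp add: c_def algebra_simps)
    have "\<eta> w + 1 = 0 \<longleftrightarrow> \<eta> w \<noteq> 0" by (cases "\<eta> w") auto
    then show ?thesis
      using True eq hit_self[OF w] unfolding Pair walk_op_apply avg
      by (auto simp: lv algebra_simps)
  next
    case False
    then show ?thesis
      unfolding Pair walk_op_apply avg by (auto simp: lv algebra_simps)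
  qed
qed

lemma occupation_lamp_value:
  assumes "tree_harmonic h" "w \<in> reduced_words q" "g \<in> states"
  shows "occupation N (lamp_value h w) g = real N * lamp_value h w g"
  by (intro occupation_harmonic walk_op_lamp_value assms)

definition lamp_at_origin :: "lamplighter_elem \<Rightarrow> real" where
  "lamp_at_origin = (\<lambda>(\<eta>, x). of_bool (\<eta> [] \<noteq> 0))"

text \<open>The indicator of the lamp being lit differs from its final probability by at most the probability of
  a further visit, whose sum over all times is finite.\<close>

lemma occupation_lamp_at_origin:
  "occupation N lamp_at_origin ((\<lambda>w. 0), []) \<le> odd_prob * real N + 2 / drift"
proof -
  have h: "tree_harmonic (\<lambda>y. 1)" by (simp add: tree_harmonic_def)
  have s: "((\<lambda>w. 0), []) \<in> states" by (simp add: states_iff)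
  have "occupation N lamp_at_origin ((\<lambda>w. 0), [])
      \<le> occupation N (\<lambda>g. lamp_value (\<lambda>y. 1) [] g + (\<lambda>(\<eta>, y). hit [] y) g) ((\<lambda>w. 0), [])"
  proof (rule occupation_mono[OF s])
    fix g :: lamplighter_elem
    obtain \<eta> y where g: "g = (\<eta>, y)" by force
    have "odd_prob * hit [] y \<le> hit [] y" "0 \<le> odd_prob * hit [] y"
      using odd_prob_bounds hit_bounds by (auto intro: mult_left_le_one_le)
    then show "lamp_at_origin g \<le> lamp_value (\<lambda>y. 1) [] g + (\<lambda>(\<eta>, y). hit [] y) g"
      using hit_bounds(1)[of "[]" y] by (simp add: g lamp_at_origin_def lamp_value_def)
  qed
  also have "\<dots> \<le> odd_prob * real N + 2 / drift"
    using occupation_hit_le[OF Nil_reduced s, of N]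
    by (simp add: occupation_add occupation_lamp_value[OF h Nil_reduced s])
      (simp add: lamp_value_def hit_self)
  finally show ?thesis .
qed

section \<open>Lamps on the other side of an edge\<close>

text \<open>The probability that the walk ends up in branch \<open>a\<close>. From \<open>[]\<close> it is \<open>1 / q\<close> by symmetry; from
  elsewhere outside, the walk has to come back to \<open>[]\<close> first, and from inside one takes complements.\<close>

definition end_in_branch :: "nat \<Rightarrow> nat list \<Rightarrow> real" where
  "end_in_branch a = by_side a (\<lambda>j. 1 - F_one ^ j / real q) (\<lambda>k. F_one ^ k / real q)"

lemma side_cases:
  obtains (origin) "y = []" | (out) k where "\<not> in_branch a y" "length y = Suc k"
    | (root) "in_branch a y" "length y = 1" | (inn) j where "in_branch a y" "length y = Suc (Suc j)"
  by (cases y; cases "tl y") auto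

lemma tree_harmonic_end_in_branch:
  assumes "a < q"
  shows "tree_harmonic (end_in_branch a)"
  unfolding tree_harmonic_def
proof
  fix y assume y: "y \<in> reduced_words q"
  note e = F_one_mult(2)
  note sum = sum_neighbours_by_side[OF y assms, of "\<lambda>j. 1 - F_one ^ j / real q"
      "\<lambda>k. F_one ^ k / real q", folded end_in_branch_def]
  show "(\<Sum>b<q. end_in_branch a (neighbour y b)) = real q * end_in_branch a y"
    using y
  proof (cases rule: side_cases[where y = y and a = a])
    case origin
    then show ?thesis
      unfolding sum using q_ge e[of 1]
      by (simp add: end_in_branch_def by_side_def field_simps)
  next
    case (out k)
    then show ?thesis unfolding sum using q_ge e[of "F_one ^ k"] e[of "F_one * F_one ^ k"]
      by (auto simp add: end_in_branch_def by_side_def field_simps)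
  next
    case root
    then show ?thesis
      unfolding sum using q_ge e[of 1] by (auto simp add: end_in_branch_def by_side_def field_simps)
  next
    case (inn j)
    have "F_one * (real q * (real q * F_one ^ j)) = real q * (real q * (F_one * F_one ^ j))"
      by simp
    then show ?thesis unfolding sum e distrib_left using inn q_ge e[of "F_one ^ j"]
      by (auto simp add: end_in_branch_def by_side_def field_simps)
  qed
qed

lemma end_in_branch_bounds: "0 \<le> end_in_branch a y" "end_in_branch a y \<le> 1"
proof -
  have "0 \<le> F_one ^ k / real q" "F_one ^ k / real q \<le> 1" for k
    using F_one q_ge power_le_one[of F_one k] by (auto simp: field_simps)
  then show "0 \<le> end_in_branch a y" "end_in_branch a y \<le> 1"
    by (simp_all add: end_in_branch_def by_side_def)
qed

lemma end_in_branch_outside: "\<not> in_branch a y \<Longrightarrow> end_in_branch a y = F_one ^ length y / real q"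
  by (auto simp: end_in_branch_def by_side_def)

text \<open>After lamp \<open>w\<close> has been switched on by the walker standing there, it is lit in the end with
  probability \<open>1 - odd_prob\<close>, independently of the walker ending up in branch \<open>a\<close>. The error term covers
  the times before the walk has settled in a branch and before its last visit to \<open>w\<close>; it does not
  depend on \<open>w\<close>.\<close>

lemma occupation_lamp_behind:
  assumes w: "w \<in> reduced_words q" and a: "a < q" and \<eta>: "\<eta> \<in> lamp_configs q" "\<eta> w \<noteq> 0"
  shows "occupation N (\<lambda>(\<eta>, x). of_bool (\<eta> w \<noteq> 0 \<and> in_branch a x)) (\<eta>, w)
    \<ge> (1 - odd_prob) * end_in_branch a w * real N - 4 / drift"
proof -
  let ?f = "\<lambda>(\<eta>, x). of_bool (\<eta> w \<noteq> 0 \<and> in_branch a x)"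
  let ?h = "end_in_branch a"
  have s: "(\<eta>, w) \<in> states" using assms by (simp add: states_iff)
  have "real N * lamp_value ?h w (\<eta>, w) = occupation N (lamp_value ?h w) (\<eta>, w)"
    by (simp add: occupation_lamp_value tree_harmonic_end_in_branch a w s)
  also have "\<dots> \<le> occupation N (\<lambda>g. ?f g + ((\<lambda>(\<eta>, y). hit [] y) g + (\<lambda>(\<eta>, y). hit w y) g)) (\<eta>, w)"
  proof (rule occupation_mono[OF s])
    fix g :: lamplighter_elem
    obtain \<zeta> y where g: "g = (\<zeta>, y)" by force
    have "odd_prob * ?h w \<le> 1" "0 \<le> odd_prob * ?h w"
      using odd_prob_bounds end_in_branch_bounds by (auto intro: mult_le_one)
    then have "odd_prob * ?h w * hit w y \<le> hit w y" "0 \<le> odd_prob * ?h w * hit w y"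
      using hit_bounds by (auto intro: mult_left_le_one_le)
    moreover have "?h y \<le> of_bool (in_branch a y) + hit [] y"
    proof (cases "in_branch a y")
      case True
      then show ?thesis
        using end_in_branch_bounds(2)[of a y] hit_bounds(1)[of "[]" y] by simp
    next
      case False
      have "F_one ^ length y / real q \<le> F_one ^ length y / 1"
        by (rule divide_left_mono) (use q_ge F_one in auto)
      then show ?thesis
        unfolding end_in_branch_outside[OF False] using False
        by (simp add: hit_def distance_Nil)
    qed
    moreover have "0 \<le> hit [] y" "0 \<le> hit w y" using hit_bounds by auto
    ultimately show "lamp_value ?h w g \<le> ?f g + ((\<lambda>(\<eta>, y). hit [] y) g + (\<lambda>(\<eta>, y). hit w y) g)"
      unfolding g lamp_value_def split by (cases "\<zeta> w = 0") simp_all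
  qed
  also have "\<dots> \<le> occupation N ?f (\<eta>, w) + (2 / drift + 2 / drift)"
    unfolding occupation_add by (intro add_mono occupation_hit_le w s Nil_reduced order_refl)
  finally show ?thesis using \<eta> hit_self[OF w] by (simp add: lamp_value_def algebra_simps)
qed

lemma F_bar_props:
  "0 < F_bar q p" "F_bar q p < 1"
  "(1 - p) * (1 + (real q - 1) * (F_bar q p)\<^sup>2) = real q * F_bar q p"
proof -
  define s where "s = 1 - p"
  define b where "b = real q - 1"
  define D where "D = (real q)\<^sup>2 - 4 * b * s\<^sup>2"
  have s: "0 < s" "s < 1" using p_pos p_less by (auto simp: s_def)
  have b: "2 \<le> b" using q_ge by (simp add: b_def)
  have F: "F_bar q p = (real q - sqrt D) / (2 * b * s)"
    by (simp add: F_bar_def s_def b_def D_def)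
  have "s\<^sup>2 < 1" using s by (simp add: abs_square_less_1)
  then have "b * s\<^sup>2 < b * 1" using b by (intro mult_strict_left_mono) auto
  then have "D > (real q)\<^sup>2 - 4 * b" by (simp add: D_def)
  moreover have "(real q)\<^sup>2 - 4 * b = (real q - 2)\<^sup>2"
    by (simp add: b_def power2_eq_square algebra_simps)
  ultimately have Dpos: "D > 0" by (metis le_less_trans zero_le_power2)
  have "sqrt D < real q"
    using s b Dpos by (intro real_less_lsqrt) (auto simp: D_def)
  then show "0 < F_bar q p" unfolding F using s b by simp
  have "D - (real q - 2 * b * s)\<^sup>2 = 4 * b * s * real q * (1 - s)"
    by (simp add: D_def b_def power2_eq_square algebra_simps)
  moreover have "4 * b * s * real q * (1 - s) > 0" using s b q_ge by simp
  ultimately have "(real q - 2 * b * s)\<^sup>2 < D" by linarith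
  then have "real q - 2 * b * s < sqrt D" by (rule real_less_rsqrt)
  then show "F_bar q p < 1" unfolding F using s b by (simp add: divide_simps)
  have "sqrt D = real q - 2 * b * s * F_bar q p" unfolding F using s b by simp
  then have "D = (real q - 2 * b * s * F_bar q p)\<^sup>2"
    using Dpos by (metis less_imp_le real_sqrt_pow2)
  then have "4 * b * s * (s * (1 + b * (F_bar q p)\<^sup>2) - real q * F_bar q p) = 0"
    by (simp add: D_def power2_eq_square algebra_simps)
  then show "(1 - p) * (1 + (real q - 1) * (F_bar q p)\<^sup>2) = real q * F_bar q p"
    using s b by (simp add: s_def b_def)
qed

text \<open>The probability, for a walk started at a vertex of the dark tree, that the lamp switched first lies
  outside branch \<open>a\<close> and is lit in the end while the walk ends up in the branch. Before the first
  switch the walk is killed at rate \<open>p\<close>, so inside the branch, where no contribution arises, this decays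
  like \<open>F_bar\<close>; outside it is a particular solution, which decays like \<open>F_one\<close>, plus a homogeneous one.
  The coefficients are chosen such that the value at \<open>[]\<close> is \<open>nu3_hat\<close>.\<close>

definition first_switch :: "nat \<Rightarrow> nat list \<Rightarrow> real" where
  "first_switch a = by_side a
     (\<lambda>j. nu3_hat q p * F_bar q p ^ Suc j)
     (\<lambda>k. (1 - odd_prob) / real q * F_one ^ k
          + (nu3_hat q p - (1 - odd_prob) / real q) * F_bar q p ^ k)"

lemma nu3_hat_eq:
  "nu3_hat q p * (1 - F_bar q p) * (1 - (1 - p) * F_bar q p) = p * ((1 - odd_prob) / real q)"
proof -
  have "(1 - p) * F_bar q p < 1"
    using F_bar_props p_pos p_less mult_strict_mono[of "1 - p" 1 "F_bar q p" 1] by simp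
  moreover have "1 - odd_prob = (real q - 2 + p) / (p * real q + real q - 2)"
    using denom_pos by (simp add: odd_prob_def field_simps)
  ultimately show ?thesis
    using F_bar_props denom_pos q_ge by (simp add: nu3_hat_def)
qed

lemma first_switch_bounded: "\<exists>B\<ge>0. \<forall>y. first_switch a y \<le> B"
proof -
  define \<nu> where "\<nu> = nu3_hat q p"
  define \<kappa> where "\<kappa> = (1 - odd_prob) / real q"
  have pw: "c * t ^ n \<le> \<bar>c\<bar>" if "0 \<le> t" "t \<le> 1" for c t :: real and n
  proof -
    have "c * t ^ n \<le> \<bar>c\<bar> * t ^ n" using that by (intro mult_right_mono) auto
    also have "\<dots> \<le> \<bar>c\<bar>" using that by (intro mult_left_le) (auto simp: power_le_one)
    finally show ?thesis .
  qed
  have F: "0 \<le> F_bar q p" "F_bar q p \<le> 1" and F1: "0 \<le> F_one" "F_one \<le> 1"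
    using F_bar_props F_one by auto
  have "first_switch a y \<le> \<bar>\<nu>\<bar> + (\<bar>\<kappa>\<bar> + \<bar>\<nu> - \<kappa>\<bar>)" for y
    unfolding first_switch_def by_side_def \<nu>_def[symmetric] \<kappa>_def[symmetric]
    using pw[OF F, of \<nu> "length y"] pw[OF F1, of \<kappa> "length y"]
      pw[OF F, of "\<nu> - \<kappa>" "length y"] by auto
  then show ?thesis by (intro exI[of _ "\<bar>\<nu>\<bar> + (\<bar>\<kappa>\<bar> + \<bar>\<nu> - \<kappa>\<bar>)"]) auto
qed

text \<open>Conditioning on the first step: a switch at \<open>y\<close> leads to the situation of \<open>occupation_lamp_behind\<close>,
  a move leaves the tree dark. Away from the edge the equation is built into the two decay rates.\<close>

lemma first_switch_eq:
  assumes y: "y \<in> reduced_words q" and a: "a < q"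
  shows "first_switch a y = (1 - p) / real q * (\<Sum>b<q. first_switch a (neighbour y b))
    + (if in_branch a y then 0 else p * ((1 - odd_prob) * end_in_branch a y))"
proof -
  define F where "F = F_bar q p"
  define \<nu> where "\<nu> = nu3_hat q p"
  define \<kappa> where "\<kappa> = (1 - odd_prob) / real q"
  define s where "s = 1 - p"
  have e: "real q * F_one = 1 + F_one" by (rule F_one)
  have quad: "s * (1 + (real q - 1) * (F * F)) = real q * F"
    using F_bar_props(3) by (simp add: F_def s_def power2_eq_square)
  have nu: "\<nu> * (1 - F) * (1 - s * F) = p * \<kappa>"
    using nu3_hat_eq by (simp add: F_def \<nu>_def \<kappa>_def s_def)
  have q0: "real q \<noteq> 0" using q_ge by simp
  have F1: "1 - F \<noteq> 0" using F_bar_props by (simp add: F_def)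
  have p: "p = 1 - s" by (simp add: s_def)
  have fs: "first_switch a = by_side a (\<lambda>j. \<nu> * F ^ Suc j) (\<lambda>k. \<kappa> * F_one ^ k + (\<nu> - \<kappa>) * F ^ k)"
    by (simp add: first_switch_def F_def \<nu>_def \<kappa>_def)
  have eb: "(1 - odd_prob) * end_in_branch a y = \<kappa> * F_one ^ length y" if "\<not> in_branch a y"
    unfolding end_in_branch_outside[OF that] by (simp add: \<kappa>_def)
  note sum = sum_neighbours_by_side[OF y a, of "\<lambda>j. \<nu> * F ^ Suc j"
      "\<lambda>k. \<kappa> * F_one ^ k + (\<nu> - \<kappa>) * F ^ k", folded fs]
  have quad': "s * (c + (real q - 1) * (F * (F * c))) = real q * (F * c)" for c
    using arg_cong[OF quad, of "\<lambda>t. t * c"] by (simp add: algebra_simps)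
  have "real q * first_switch a y = s * (\<Sum>b<q. first_switch a (neighbour y b))
    + real q * (if in_branch a y then 0 else p * ((1 - odd_prob) * end_in_branch a y))"
  proof (cases rule: side_cases[where y = y and a = a])
    case origin
    \<comment> \<open>Here the two halves of the tree have to fit together, and this determines \<open>nu3_hat\<close>. The factor
      \<open>1 - F\<close> clears the denominator of \<open>nu3_hat\<close>.\<close>
    have "(1 - F) * (real q * \<nu>) = (1 - F) *
      (s * (\<nu> * F + (real q - 1) * (\<kappa> * F_one + (\<nu> - \<kappa>) * F)) + real q * (p * \<kappa>))"
      using e quad nu p by algebra
    then show ?thesis using sum origin F1 eb by (simp add: fs by_side_def)
  next
    case (out k)
    have "s * (\<kappa> * F_one ^ k + (real q - 1) * (F_one * (\<kappa> * (F_one * F_one ^ k))))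
      + real q * (p * (\<kappa> * (F_one * F_one ^ k))) = real q * (\<kappa> * (F_one * F_one ^ k))"
      unfolding F_one_mult(1) using arg_cong[OF e, of "\<lambda>t. t * \<kappa> * F_one ^ k * s"]
      by (simp add: p algebra_simps)
    moreover have "first_switch a y = \<kappa> * F_one ^ Suc k + (\<nu> - \<kappa>) * F ^ Suc k"
      using out by (auto simp: fs by_side_def)
    moreover have "(if in_branch a y then 0 else p * ((1 - odd_prob) * end_in_branch a y))
        = p * (\<kappa> * F_one ^ Suc k)" using out eb by auto
    moreover have "(\<Sum>b<q. first_switch a (neighbour y b)) = \<kappa> * F_one ^ k + (\<nu> - \<kappa>) * F ^ k
        + (real q - 1) * (\<kappa> * F_one ^ Suc (Suc k) + (\<nu> - \<kappa>) * F ^ Suc (Suc k))"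
      using out by (auto simp: sum)
    ultimately show ?thesis
      using quad'[of "(\<nu> - \<kappa>) * F ^ k"] by (simp only:) (simp add: algebra_simps)
  next
    case root
    then show ?thesis using quad'[of \<nu>] by (simp add: sum) (simp add: fs by_side_def algebra_simps)
  next
    case (inn j)
    then show ?thesis using quad'[of "\<nu> * F * F ^ j"]
      by (simp add: sum) (simp add: fs by_side_def algebra_simps)
  qed
  then show ?thesis using q0 by (simp add: field_simps s_def)
qed

definition lamp_behind :: "nat \<Rightarrow> lamplighter_elem \<Rightarrow> real" where
  "lamp_behind a = (\<lambda>(\<eta>, x). of_bool (in_branch a x \<and> (\<exists>w. \<not> in_branch a w \<and> \<eta> w \<noteq> 0)))"

definition lamp_in_branch :: "nat \<Rightarrow> lamplighter_elem \<Rightarrow> real" where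
  "lamp_in_branch a = (\<lambda>(\<eta>, x). of_bool (\<not> in_branch a x \<and> (\<exists>w. in_branch a w \<and> \<eta> w \<noteq> 0)))"

text \<open>Induction on time for all starting points at once, conditioning on the first step. The error \<open>C\<close> is
  the same everywhere: with probability \<open>1 - p\<close> the step is a move, which passes \<open>C\<close> on, so each round
  has \<open>p * C\<close> to spare, and this has to cover the error \<open>p * K\<close> of a switch and the bound \<open>B\<close> of the term
  that the additional time step contributes.\<close>

lemma occupation_lamp_behind_ge:
  assumes a: "a < q"
  shows "\<exists>C. \<forall>N. occupation N (lamp_behind a) ((\<lambda>w. 0), []) \<ge> nu3_hat q p * real N - C"
proof -
  obtain B where B: "B \<ge> 0" "\<And>y. first_switch a y \<le> B" using first_switch_bounded by blast
  define K where "K = 4 / drift"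
  define C where "C = K + B / p"
  have K: "K \<ge> 0" using drift_pos by (simp add: K_def)
  have C: "p * C = p * K + B" using p_pos by (simp add: C_def distrib_left)
  have main: "occupation N (lamp_behind a) ((\<lambda>w. 0), y) \<ge> first_switch a y * real N - C"
    if "y \<in> reduced_words q" for y N
    using that
  proof (induction N arbitrary: y)
    case 0
    have "C \<ge> 0" using B K p_pos by (simp add: C_def)
    then show ?case by simp
  next
    case (Suc N)
    note y = Suc.prems
    let ?\<delta> = "(\<lambda>w. 0 :: bit)(y := 1)"
    let ?src = "if in_branch a y then 0 else (1 - odd_prob) * end_in_branch a y"
    have \<delta>: "?\<delta> \<in> lamp_configs q" "(?\<delta>, y) \<in> states"
      using y by (auto simp: lamp_configs_upd states_iff simp del: fun_upd_apply)
    have "occupation N (lamp_behind a) (?\<delta>, y) \<ge> ?src * real N - K"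
    proof (cases "in_branch a y")
      case True
      then show ?thesis
        using occupation_nonneg[OF \<delta>(2), of "lamp_behind a" N] K by (auto simp: lamp_behind_def)
    next
      case False
      have "(1 - odd_prob) * end_in_branch a y * real N - K
          \<le> occupation N (\<lambda>(\<eta>, x). of_bool (\<eta> y \<noteq> 0 \<and> in_branch a x)) (?\<delta>, y)"
        unfolding K_def by (rule occupation_lamp_behind[OF y a \<delta>(1)]) simp
      also have "\<dots> \<le> occupation N (lamp_behind a) (?\<delta>, y)"
        by (rule occupation_mono[OF \<delta>(2)]) (use False in \<open>auto simp: lamp_behind_def\<close>)
      finally show ?thesis using False by auto
    qed
    then have "p * (?src * real N - K) \<le> p * occupation N (lamp_behind a) (?\<delta>, y)"
      using p_pos by (intro mult_left_mono) auto
    moreover have "(1 - p) / real q * (\<Sum>b<q. first_switch a (neighbour y b) * real N - C)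
        \<le> (1 - p) / real q * (\<Sum>b<q. occupation N (lamp_behind a) ((\<lambda>w. 0), neighbour y b))"
      using p_less by (intro mult_left_mono sum_mono Suc.IH neighbour_reduced y) auto
    moreover have "(1 - p) / real q * (\<Sum>b<q. first_switch a (neighbour y b) * real N - C)
        = (first_switch a y - p * ?src) * real N - (1 - p) * C"
    proof -
      have "(1 - p) / real q * (\<Sum>b<q. first_switch a (neighbour y b) * real N - C)
          = (1 - p) / real q * (\<Sum>b<q. first_switch a (neighbour y b)) * real N - (1 - p) * C"
        using q_ge by (simp add: sum_subtractf right_diff_distrib flip: sum_distrib_right)
      also have "(1 - p) / real q * (\<Sum>b<q. first_switch a (neighbour y b))
          = first_switch a y - p * ?src"
        using first_switch_eq[OF y a] by auto
      finally show ?thesis .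
    qed
    moreover have "occupation (Suc N) (lamp_behind a) ((\<lambda>w. 0), y) =
        p * occupation N (lamp_behind a) (?\<delta>, y)
        + (1 - p) / real q * (\<Sum>b<q. occupation N (lamp_behind a) ((\<lambda>w. 0), neighbour y b))"
      by (simp add: occupation_Suc walk_op_apply lamp_behind_def)
    ultimately have "occupation (Suc N) (lamp_behind a) ((\<lambda>w. 0), y)
        \<ge> first_switch a y * real N - p * K - (1 - p) * C"
      by (simp only:) (simp add: algebra_simps)
    moreover have "first_switch a y * real N - p * K - (1 - p) * C
        = first_switch a y * real N + B - C"
      using C by (simp add: algebra_simps)
    ultimately show ?case using B(2)[of y] by (simp add: algebra_simps)
  qed
  have "first_switch a [] = nu3_hat q p" by (simp add: first_switch_def by_side_def)
  then show ?thesis using main[OF Nil_reduced] by metis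
qed

lemma left_letter_involution:
  assumes "g \<in> states" "a < q"
  shows "left_letter q a (left_letter q a g) = g"
proof (cases g)
  case (Pair \<eta> x)
  have "\<eta> w = 0" if "w \<notin> reduced_words q" for w
    using assms that Pair by (auto simp: states_iff lamp_configs_def)
  moreover have "x \<in> reduced_words q" using assms Pair by (simp add: states_iff)
  ultimately show ?thesis
    using Pair push_letter_involution push_letter_reduced assms(2)
    by (auto simp: left_letter_def fun_eq_iff)
qed

lemma in_branch_push_letter:
  assumes "x \<in> reduced_words q"
  shows "in_branch a (push_letter a x) \<longleftrightarrow> \<not> in_branch a x"
  using assms by (cases "(a, x)" rule: push_letter.cases) (auto simp: reduced_Cons)

text \<open>Left multiplication by \<open>a\<close> exchanges the two ends of the edge between \<open>[]\<close> and \<open>[a]\<close>.\<close>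

lemma lamp_in_branch_left_letter:
  assumes "g \<in> states" "a < q"
  shows "lamp_in_branch a (left_letter q a g) = lamp_behind a g"
proof (cases g)
  case (Pair \<eta> x)
  then have \<eta>: "\<eta> \<in> lamp_configs q" and x: "x \<in> reduced_words q"
    using assms by (auto simp: states_iff)
  have "(\<exists>w. in_branch a w \<and> fst (left_letter q a g) w \<noteq> 0)
      \<longleftrightarrow> (\<exists>w\<in>push_letter a ` {w. \<eta> w \<noteq> 0}. in_branch a w)"
    unfolding Pair supp_left_letter[OF \<eta> assms(2), of x, symmetric] by auto
  also have "\<dots> \<longleftrightarrow> (\<exists>w. \<not> in_branch a w \<and> \<eta> w \<noteq> 0)"
    using \<eta> in_branch_push_letter[of _ a] by (auto simp: lamp_configs_def)
  finally show ?thesis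
    using in_branch_push_letter[OF x, of a]
    by (simp only: Pair lamp_in_branch_def lamp_behind_def left_letter_def split fst_conv) simp
qed

lemma occupation_left_letter:
  assumes "g \<in> states" "a < q"
  shows "occupation N f (left_letter q a g) = occupation N (f \<circ> left_letter q a) g"
  unfolding occupation_def by (intro sum.cong refl iterate_left_letter assms)

text \<open>The walker stands at \<open>[a]\<close> and its half of the tree is dark; the reflection that exchanges the halves
  turns this into a walk from \<open>[]\<close> with everything outside branch \<open>a\<close> dark, and lamps inside the branch
  do not matter for \<open>lamp_behind\<close>.\<close>

lemma occupation_lamp_in_branch_root:
  assumes g: "(\<eta>, [a]) \<in> states" and a: "a < q" and dark: "\<And>w. in_branch a w \<Longrightarrow> \<eta> w = 0"
  shows "occupation N (lamp_in_branch a) (\<eta>, [a]) = occupation N (lamp_behind a) ((\<lambda>w. 0), [])"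
proof -
  define \<zeta> where "\<zeta> = fst (left_letter q a (\<eta>, [a]))"
  have L: "left_letter q a (\<eta>, [a]) = (\<zeta>, [])" by (simp add: \<zeta>_def left_letter_def)
  have s: "(\<zeta>, []) \<in> states" using left_letter_states[OF g a] by (simp add: L)
  have \<zeta>: "\<zeta> w = 0" if "\<not> in_branch a w" for w
    using in_branch_push_letter[of w a] dark that by (auto simp: \<zeta>_def left_letter_def)
  have "occupation N (lamp_in_branch a) (\<eta>, [a])
      = occupation N (lamp_in_branch a) (left_letter q a (\<zeta>, []))"
    using left_letter_involution[OF g a] by (simp add: L)
  also have "\<dots> = occupation N (lamp_in_branch a \<circ> left_letter q a) (\<zeta>, [])"
    by (rule occupation_left_letter[OF s a])
  also have "\<dots> = occupation N (lamp_behind a) (\<zeta>, [])"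
    by (intro antisym occupation_mono s) (simp_all add: lamp_in_branch_left_letter a)
  also have "\<dots> = occupation N (lamp_behind a) ((\<lambda>w. 0), [])"
  proof -
    have local: "lamp_behind a (\<eta>1, x) = lamp_behind a (\<eta>2, x)"
      if "\<forall>w\<in>{w. \<not> in_branch a w}. \<eta>1 w = \<eta>2 w" for \<eta>1 \<eta>2 x
    proof -
      have eq: "(\<exists>w. \<not> in_branch a w \<and> \<eta>1 w \<noteq> 0) \<longleftrightarrow> (\<exists>w. \<not> in_branch a w \<and> \<eta>2 w \<noteq> 0)"
        by (intro ex_cong1 conj_cong refl) (use that in auto)
      show ?thesis unfolding lamp_behind_def split eq ..
    qed
    have "(walk_op ^^ n) (lamp_behind a) (\<zeta>, []) = (walk_op ^^ n) (lamp_behind a) ((\<lambda>w. 0), [])"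
      for n
    proof (rule iterate_local)
      show "\<forall>w\<in>{w. \<not> in_branch a w}. \<zeta> w = 0" using \<zeta> by blast
    qed (rule local)
    then show ?thesis by (simp add: occupation_def)
  qed
  finally show ?thesis .
qed

text \<open>To light a lamp in a dark branch the walker has to enter it through \<open>[a]\<close>. From \<open>x\<close> this happens with
  probability \<open>F_one ^ Suc (length x)\<close>, and at the first entrance the situation is that of the preceding
  lemma, with less time left.\<close>

lemma occupation_lamp_in_branch_le:
  assumes "(\<eta>, x) \<in> states" "\<not> in_branch a x" and a: "a < q"
    and "\<And>w. in_branch a w \<Longrightarrow> \<eta> w = 0"
  shows "occupation N (lamp_in_branch a) (\<eta>, x)
    \<le> F_one ^ Suc (length x) * occupation N (lamp_behind a) ((\<lambda>w. 0), [])"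
  using assms(1,2,4)
proof (induction N arbitrary: \<eta> x)
  case 0
  then show ?case by simp
next
  case (Suc N)
  define S where "S = occupation N (lamp_behind a) ((\<lambda>w. 0), [])"
  have s0: "((\<lambda>w. 0), []) \<in> states" by (simp add: states_iff)
  have lb: "0 \<le> lamp_behind a g" for g by (cases g) (auto simp: lamp_behind_def)
  have S: "0 \<le> S" "S \<le> occupation (Suc N) (lamp_behind a) ((\<lambda>w. 0), [])"
    unfolding S_def using lb by (auto intro!: occupation_nonneg occupation_mono_time s0)
  have x: "x \<in> reduced_words q" and \<eta>: "\<eta> \<in> lamp_configs q"
    using Suc.prems(1) by (auto simp: states_iff)
  have "occupation N (lamp_in_branch a) (\<eta>(x := \<eta> x + 1), x) \<le> F_one ^ Suc (length x) * S"
    unfolding S_def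
  proof (rule Suc.IH)
    show "(\<eta>(x := \<eta> x + 1), x) \<in> states"
      by (simp add: states_iff lamp_configs_upd x \<eta> del: fun_upd_apply)
  qed (use Suc.prems in auto)
  then have "p * occupation N (lamp_in_branch a) (\<eta>(x := \<eta> x + 1), x)
      \<le> p * (F_one ^ Suc (length x) * S)" using p_pos by (intro mult_left_mono) auto
  moreover have "(\<Sum>b<q. occupation N (lamp_in_branch a) (\<eta>, neighbour x b))
      \<le> real q * F_one ^ Suc (length x) * S"
  proof -
    have "occupation N (lamp_in_branch a) (\<eta>, neighbour x b)
        \<le> by_side a (\<lambda>j. 1) (\<lambda>k. F_one ^ Suc k) (neighbour x b) * S" if b: "b < q" for b
    proof (cases "in_branch a (neighbour x b)")
      case False
      then show ?thesis
        using Suc.IH[of \<eta> "neighbour x b"] Suc.prems neighbour_reduced[OF x b] \<eta>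
        by (auto simp: by_side_def S_def states_iff)
    next
      case True
      then have "neighbour x b = [a]"
        using Suc.prems(2) neighbour_eq[OF x, of b]
        by (cases x) (auto split: if_splits)
      then show ?thesis
        using occupation_lamp_in_branch_root[OF _ a, of \<eta> N] Suc.prems a \<eta>
        by (simp add: by_side_def S_def states_iff reduced_Cons)
    qed
    then have "(\<Sum>b<q. occupation N (lamp_in_branch a) (\<eta>, neighbour x b))
        \<le> (\<Sum>b<q. by_side a (\<lambda>j. 1) (\<lambda>k. F_one ^ Suc k) (neighbour x b)) * S"
      unfolding sum_distrib_right by (intro sum_mono) auto
    also have "(\<Sum>b<q. by_side a (\<lambda>j. 1) (\<lambda>k. F_one ^ Suc k) (neighbour x b))
        = real q * F_one ^ Suc (length x)"
      using Suc.prems(2) F_one(1) F_one_mult(2)[of "F_one * F_one ^ length (tl x)"]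
        F_one_mult(2)[of "F_one * (F_one * F_one ^ length (tl x))"]
      unfolding sum_neighbours_by_side[OF x a] by (cases x) (auto simp: algebra_simps)
    finally show ?thesis by simp
  qed
  then have "(1 - p) / real q * (\<Sum>b<q. occupation N (lamp_in_branch a) (\<eta>, neighbour x b))
      \<le> (1 - p) / real q * (real q * F_one ^ Suc (length x) * S)"
    using p_less by (intro mult_left_mono) auto
  moreover have "(1 - p) / real q * (real q * F_one ^ Suc (length x) * S)
      = F_one ^ Suc (length x) * S - p * (F_one ^ Suc (length x) * S)"
  proof -
    have "(1 - p) / real q * (real q * c * S) = c * S - p * (c * S)" for c
      using q_ge by (simp add: field_simps)
    then show ?thesis .
  qed
  moreover have "lamp_in_branch a (\<eta>, x) = 0" using Suc.prems by (auto simp: lamp_in_branch_def)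
  ultimately have "occupation (Suc N) (lamp_in_branch a) (\<eta>, x) \<le> F_one ^ Suc (length x) * S"
    unfolding occupation_Suc walk_op_apply by linarith
  also have "\<dots> \<le> F_one ^ Suc (length x) * occupation (Suc N) (lamp_behind a) ((\<lambda>w. 0), [])"
    using S F_one by (intro mult_left_mono) auto
  finally show ?case .
qed

end

section \<open>The length of a tour\<close>

text \<open>An edge of the tree is represented by its end point farther from \<open>[]\<close>; the edges of \<open>detour (\<eta>, x)\<close> are
  those on the way from \<open>[]\<close> to a lit lamp that are not on the way to \<open>x\<close>. A tour has to use them twice.\<close>

definition detour :: "lamplighter_elem \<Rightarrow> nat list set" where
  "detour = (\<lambda>(\<eta>, x). {v. \<not> prefix v x \<and> (\<exists>w. \<eta> w \<noteq> 0 \<and> prefix v w)})"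

definition tour :: "lamplighter_elem \<Rightarrow> real" where
  "tour = (\<lambda>(\<eta>, x).
     real (card {w. \<eta> w \<noteq> 0}) + real (length x) + 2 * real (card (detour (\<eta>, x))))"

lemma finite_detour:
  assumes "finite {w. \<eta> w \<noteq> 0}"
  shows "finite (detour (\<eta>, x))"
proof (rule finite_subset)
  show "detour (\<eta>, x) \<subseteq> (\<Union>w\<in>{w. \<eta> w \<noteq> 0}. set (prefixes w))"
    by (auto simp: detour_def)
qed (use assms in auto)

lemma card_supp_switch:
  fixes \<eta> :: "nat list \<Rightarrow> bit"
  assumes "finite {w. \<eta> w \<noteq> 0}"
  shows "real (card {w. (\<eta>(x := \<eta> x + 1)) w \<noteq> 0})
    = real (card {w. \<eta> w \<noteq> 0}) + 1 - 2 * of_bool (\<eta> x \<noteq> 0)"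
proof (cases "\<eta> x = 0")
  case True
  then have "{w. (\<eta>(x := \<eta> x + 1)) w \<noteq> 0} = insert x {w. \<eta> w \<noteq> 0}" by auto
  then show ?thesis using True assms by simp
next
  case False
  then have "{w. (\<eta>(x := \<eta> x + 1)) w \<noteq> 0} = {w. \<eta> w \<noteq> 0} - {x}" "x \<in> {w. \<eta> w \<noteq> 0}"
    by (auto split: if_splits)
  moreover have "card {w. \<eta> w \<noteq> 0} > 0" using False assms by (auto simp: card_gt_0_iff)
  ultimately show ?thesis using False assms by (simp add: of_nat_diff Suc_le_eq)
qed

lemma tour_switch:
  assumes "finite {w. \<eta> w \<noteq> 0}" "prefix y x"
  shows "tour (\<eta>(y := \<eta> y + 1), x) = tour (\<eta>, x) + 1 - 2 * of_bool (\<eta> y \<noteq> 0)"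
proof -
  have "w \<noteq> y" if "prefix v w" "\<not> prefix v x" for v w
    using that assms(2) prefix_order.trans by blast
  then have "detour (\<eta>(y := \<eta> y + 1), x) = detour (\<eta>, x)"
    unfolding detour_def split by (intro Collect_cong conj_cong[OF refl] ex_cong1) auto
  then show ?thesis
    unfolding tour_def split card_supp_switch[OF assms(1)] by simp
qed

text \<open>The new edge leads to \<open>x @ [b]\<close>. If it was on a detour it ceases to be, which saves \<open>2\<close> and more than
  compensates for the longer geodesic.\<close>

lemma tour_append:
  assumes "finite {w. \<eta> w \<noteq> 0}"
  shows "\<bar>tour (\<eta>, x @ [b]) - tour (\<eta>, x)\<bar> = 1"
proof -
  have d: "detour (\<eta>, x @ [b]) = detour (\<eta>, x) - {x @ [b]}"
    by (auto simp: detour_def)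
  have "card (detour (\<eta>, x)) > 0" if "x @ [b] \<in> detour (\<eta>, x)"
    using that finite_detour[OF assms] by (auto simp: card_gt_0_iff)
  then show ?thesis
    using finite_detour[OF assms, of x] unfolding tour_def split d
    by (cases "x @ [b] \<in> detour (\<eta>, x)") (auto simp: of_nat_diff Suc_le_eq)
qed

lemma tour_neighbour:
  assumes "finite {w. \<eta> w \<noteq> 0}" "x \<in> reduced_words q"
  shows "\<bar>tour (\<eta>, neighbour x b) - tour (\<eta>, x)\<bar> = 1"
proof (cases "x \<noteq> [] \<and> last x = b")
  case True
  then have "x = neighbour x b @ [b]" using neighbour_eq[OF assms(2), of b] by auto
  then show ?thesis using tour_append[OF assms(1), of "neighbour x b" b] by simp
next
  case False
  then show ?thesis using neighbour_eq[OF assms(2), of b] tour_append[OF assms(1), of x b] by auto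
qed

lemma prefix_ConsD: "prefix (c # u) w \<Longrightarrow> w \<noteq> [] \<and> hd w = c"
  by (cases w) auto

text \<open>Left multiplication by \<open>a\<close> is an automorphism of the tree, and it preserves which end of an edge is
  farther from \<open>[]\<close>, except for the edge between \<open>[]\<close> and \<open>[a]\<close>.\<close>

lemma prefix_push_letter:
  assumes "v \<in> reduced_words q" "w \<in> reduced_words q" "v \<noteq> []" "v \<noteq> [a]"
  shows "prefix (push_letter a v) (push_letter a w) \<longleftrightarrow> prefix v w"
  using assms
  by (cases "(a, v)" rule: push_letter.cases; cases "(a, w)" rule: push_letter.cases)
    (auto simp: reduced_Cons neq_Nil_conv prefix_Cons dest!: prefix_ConsD)

lemma prefix_reduced: "prefix v w \<Longrightarrow> w \<in> reduced_words q \<Longrightarrow> v \<in> reduced_words q"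
  by (auto simp: prefix_def reduced_words_iff distinct_adj_append_iff)

lemma prefix_singleton: "prefix [a] w \<longleftrightarrow> in_branch a w"
  by (cases w) auto

context lamplighter_walk
begin

text \<open>The inequality, applied once more to the translated state, gives equality.\<close>

lemma detour_left_letter:
  assumes g: "g \<in> states" and a: "a < q"
  shows "card (detour g - {[a]}) \<le> card (detour (left_letter q a g) - {[a]})"
proof (cases g)
  case (Pair \<eta> x)
  then have \<eta>: "\<eta> \<in> lamp_configs q" and x: "x \<in> reduced_words q"
    using g by (auto simp: states_iff)
  define \<zeta> where "\<zeta> = fst (left_letter q a g)"
  have L: "left_letter q a g = (\<zeta>, push_letter a x)" by (simp add: \<zeta>_def Pair left_letter_def)
  have supp: "{w. \<zeta> w \<noteq> 0} = push_letter a ` {w. \<eta> w \<noteq> 0}"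
    unfolding \<zeta>_def Pair by (rule supp_left_letter[OF \<eta> a])
  have red: "w \<in> reduced_words q" if "\<eta> w \<noteq> 0" for w
    using \<eta> that by (auto simp: lamp_configs_def)
  have v: "v \<in> reduced_words q" "v \<noteq> []" if "v \<in> detour g" for v
    using that red prefix_reduced by (auto simp: detour_def Pair)
  have "push_letter a v \<in> detour (left_letter q a g) - {[a]}" if d: "v \<in> detour g - {[a]}" for v
  proof -
    obtain w where w: "\<eta> w \<noteq> 0" "prefix v w" using d by (auto simp: detour_def Pair)
    have "\<zeta> (push_letter a w) \<noteq> 0" using supp w(1) by blast
    moreover have "prefix (push_letter a v) (push_letter a w)"
      using prefix_push_letter v red w d by blast
    moreover have "\<not> prefix (push_letter a v) (push_letter a x)"
      using prefix_push_letter[OF v(1) x v(2)] d by (auto simp: detour_def Pair)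
    moreover have "push_letter a v \<noteq> [a]"
      using push_letter_involution[OF v(1)] v(2) d by (metis DiffD1 push_letter.simps(2))
    ultimately show ?thesis by (auto simp: detour_def L)
  qed
  moreover have "inj_on (push_letter a) (detour g - {[a]})"
    using v push_letter_involution by (metis DiffD1 inj_onI)
  moreover have "finite (detour (left_letter q a g) - {[a]})"
    unfolding L using supp \<eta> by (intro finite_Diff finite_detour) (simp add: lamp_configs_def)
  ultimately show ?thesis by (intro card_inj_on_le[of "push_letter a"]) auto
qed

text \<open>Only the edge between \<open>[]\<close> and \<open>[a]\<close> matters. It belongs to the detour before the multiplication if
  there are lit lamps in the branch but the walker is outside, and afterwards if there are lit lamps
  outside but the walker is in the branch.\<close>

lemma tour_left_letter:
  assumes g: "g \<in> states" and a: "a < q"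
  shows "tour (left_letter q a g) = tour g + 1 - 2 * of_bool (in_branch a (snd g))
    + 2 * lamp_behind a g - 2 * lamp_in_branch a g"
proof (cases g)
  case (Pair \<eta> x)
  then have \<eta>: "\<eta> \<in> lamp_configs q" and x: "x \<in> reduced_words q"
    using g by (auto simp: states_iff)
  have Lg: "left_letter q a g \<in> states" by (rule left_letter_states[OF g a])
  have card_detour: "real (card (detour h)) = real (card (detour h - {[a]})) + lamp_in_branch a h"
    if h: "h \<in> states" for h
  proof (cases h)
    case (Pair \<theta> y)
    have "finite (detour h)"
      unfolding Pair using h Pair by (intro finite_detour) (simp add: states_iff lamp_configs_def)
    moreover have "lamp_in_branch a h = of_bool ([a] \<in> detour h)"
      by (simp only: lamp_in_branch_def detour_def Pair split mem_Collect_eq prefix_singleton)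
        (simp add: conj_commute)
    moreover have "card (detour h) > 0" if "[a] \<in> detour h"
      using that \<open>finite (detour h)\<close> card_gt_0_iff by blast
    ultimately show ?thesis
      by (cases "[a] \<in> detour h") (auto simp: of_nat_diff Suc_le_eq)
  qed
  have "card (detour (left_letter q a g) - {[a]}) = card (detour g - {[a]})"
    using detour_left_letter[OF g a] detour_left_letter[OF Lg a]
    by (simp add: left_letter_involution[OF g a])
  then have "real (card (detour (left_letter q a g)))
      = real (card (detour g)) + lamp_behind a g - lamp_in_branch a g"
    using card_detour[OF g] card_detour[OF Lg] lamp_in_branch_left_letter[OF g a] by simp
  moreover have "card {w. fst (left_letter q a g) w \<noteq> 0} = card {w. \<eta> w \<noteq> 0}"
    unfolding Pair supp_left_letter[OF \<eta> a] using \<eta> push_letter_involution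
    by (intro card_image inj_onI) (metis (mono_tags, lifting) lamp_configs_def mem_Collect_eq subsetD)
  moreover have "real (length (push_letter a x))
      = real (length x) + 1 - 2 * of_bool (in_branch a x)"
    by (cases "(a, x)" rule: push_letter.cases) auto
  moreover have "tour h = real (card {w. fst h w \<noteq> 0}) + real (length (snd h))
      + 2 * real (card (detour h))" for h
    by (cases h) (simp add: tour_def)
  moreover have "snd (left_letter q a g) = push_letter a x"
    by (simp add: Pair left_letter_def)
  ultimately show ?thesis using Pair by simp
qed

lemma tour_switch_origin:
  assumes "g \<in> states"
  shows "tour (switch_origin g) = tour g + 1 - 2 * lamp_at_origin g"
proof (cases g)
  case (Pair \<eta> x)
  then have "finite {w. \<eta> w \<noteq> 0}" using assms by (simp add: states_iff lamp_configs_def)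
  from tour_switch[OF this, of "[]" x] show ?thesis
    by (simp only: Pair switch_origin_def lamp_at_origin_def split) simp
qed

text \<open>The mean gain of \<open>tour\<close> when a random generator is multiplied from the left.\<close>

definition tour_gain :: "lamplighter_elem \<Rightarrow> real" where
  "tour_gain g = p * (1 - 2 * lamp_at_origin g) + (1 - p) / real q *
     (\<Sum>a<q. 1 - 2 * of_bool (in_branch a (snd g)) + 2 * lamp_behind a g - 2 * lamp_in_branch a g)"

text \<open>The first step of the walk from the identity amounts to a left multiplication of everything that
  follows, so the expected gain from time \<open>n\<close> to time \<open>n + 1\<close> is the mean of \<open>tour_gain\<close> at time \<open>n\<close>.\<close>

lemma iterate_tour:
  "(walk_op ^^ N) tour ((\<lambda>w. 0), []) = occupation N tour_gain ((\<lambda>w. 0), [])"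
proof (induction N)
  case 0
  then show ?case by (simp add: tour_def detour_def)
next
  case (Suc N)
  let ?g = "((\<lambda>w. 0), []) :: lamplighter_elem"
  have s: "?g \<in> states" by (simp add: states_iff)
  have L: "left_letter q a ?g = ((\<lambda>w. 0), [a])" for a by (auto simp: left_letter_def)
  have O: "switch_origin ?g = ((\<lambda>w. 0)([] := 1), [])" by (simp add: switch_origin_def)
  have "(walk_op ^^ Suc N) tour ?g
      = p * (walk_op ^^ N) tour (switch_origin ?g)
        + (1 - p) / real q * (\<Sum>a<q. (walk_op ^^ N) tour (left_letter q a ?g))"
    by (simp add: walk_op_apply L O neighbour_def)
  also have "\<dots> = p * (walk_op ^^ N) (tour \<circ> switch_origin) ?g
      + (1 - p) / real q * (\<Sum>a<q. (walk_op ^^ N) (tour \<circ> left_letter q a) ?g)"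
    using iterate_left_letter[OF s, of _ N tour] iterate_switch_origin[OF s, of N tour]
    by simp
  also have "\<dots> = (walk_op ^^ N) (\<lambda>g. p * (tour \<circ> switch_origin) g
      + (1 - p) / real q * (\<Sum>a<q. (tour \<circ> left_letter q a) g)) ?g"
    by (simp only: iterate_linear iterate_sum)
  also have "\<dots> = (walk_op ^^ N) (\<lambda>g. tour g + tour_gain g) ?g"
  proof -
    have eq: "p * (tour \<circ> switch_origin) g + (1 - p) / real q * (\<Sum>a<q. (tour \<circ> left_letter q a) g)
        = tour g + tour_gain g" if "g \<in> states" for g
    proof -
      have "(\<Sum>a<q. (tour \<circ> left_letter q a) g) = (\<Sum>a<q. tour g + (1
          - 2 * of_bool (in_branch a (snd g)) + 2 * lamp_behind a g - 2 * lamp_in_branch a g))"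
        by (intro sum.cong refl) (simp add: tour_left_letter[OF that])
      also have "(1 - p) / real q * \<dots> = (1 - p) * tour g + (1 - p) / real q * (\<Sum>a<q. 1
          - 2 * of_bool (in_branch a (snd g)) + 2 * lamp_behind a g - 2 * lamp_in_branch a g)"
        using q_ge by (simp add: sum.distrib[of "\<lambda>a. tour g"] distrib_left)
      finally show ?thesis
        unfolding o_apply tour_switch_origin[OF that] tour_gain_def by (simp add: algebra_simps)
    qed
    then show ?thesis by (intro antisym iterate_mono s) auto
  qed
  also have "\<dots> = (walk_op ^^ N) tour ?g + (walk_op ^^ N) tour_gain ?g"
    by (simp add: iterate_linear)
  finally show ?case by (simp add: Suc.IH occupation_def)
qed

text \<open>The walker is in at most one branch, which accounts for the term \<open>real q - 2\<close>; the frequencies of the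
  other terms have been bounded. The factor \<open>1 - F_one\<close> is what remains of \<open>lamp_behind\<close> after
  \<open>lamp_in_branch\<close> has been subtracted.\<close>

lemma iterate_tour_ge:
  "\<exists>K. \<forall>N. (walk_op ^^ N) tour ((\<lambda>w. 0), []) \<ge>
     (1 - p) * (real q - 2) / real q *
       (1 + 2 * real q / (real q - 1) * nu3_hat q p + p * real q / (p * real q + real q - 2))
     * real N - K"
proof -
  let ?g = "((\<lambda>w. 0), []) :: lamplighter_elem"
  have s: "?g \<in> states" by (simp add: states_iff)
  define \<nu> where "\<nu> = nu3_hat q p"
  have "\<forall>a. \<exists>C. a < q \<longrightarrow> (\<forall>N. occupation N (lamp_behind a) ?g \<ge> \<nu> * real N - C)"
    using occupation_lamp_behind_ge by (auto simp: \<nu>_def)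
  then obtain C where C: "\<And>a N. a < q \<Longrightarrow> occupation N (lamp_behind a) ?g \<ge> \<nu> * real N - C a"
    by metis
  define K where "K = 2 * p * (2 / drift) + (1 - p) / real q * (\<Sum>a<q. 2 * (1 - F_one) * C a)"
  have "(walk_op ^^ N) tour ?g \<ge> (p * (1 - 2 * odd_prob)
      + (1 - p) / real q * (real q - 2 + real q * (2 * (1 - F_one) * \<nu>))) * real N - K" for N
  proof -
    have "occupation N (lamp_behind a) ?g - occupation N (lamp_in_branch a) ?g
        \<ge> (1 - F_one) * (\<nu> * real N - C a)" if "a < q" for a
    proof -
      have "occupation N (lamp_in_branch a) ?g \<le> F_one * occupation N (lamp_behind a) ?g"
        using occupation_lamp_in_branch_le[OF s _ that, of N] by simp
      moreover have "(1 - F_one) * (\<nu> * real N - C a) \<le> (1 - F_one) * occupation N (lamp_behind a) ?g"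
        using C[OF that] F_one by (intro mult_left_mono) auto
      ultimately show ?thesis by (simp add: algebra_simps)
    qed
    then have "(1 - p) / real q * (\<Sum>a<q. 2 * ((1 - F_one) * (\<nu> * real N - C a)))
        \<le> (1 - p) / real q * (\<Sum>a<q. 2 * (occupation N (lamp_behind a) ?g
              - occupation N (lamp_in_branch a) ?g))"
      using p_less by (intro mult_left_mono sum_mono) auto
    moreover have "(1 - p) / real q * (\<Sum>a<q. 2 * ((1 - F_one) * (\<nu> * real N - C a)))
        = (1 - p) / real q * (real q * (2 * (1 - F_one) * \<nu>)) * real N
          - (1 - p) / real q * (\<Sum>a<q. 2 * (1 - F_one) * C a)"
      by (simp add: algebra_simps sum_subtractf sum_distrib_left sum.distrib)
    moreover have "occupation N (\<lambda>g. p + ((- 2 * p) * lamp_at_origin g + (1 - p) / real q * (real q - 2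
        + (\<Sum>a<q. 2 * (lamp_behind a g + (- 1) * lamp_in_branch a g))))) ?g
      \<le> occupation N tour_gain ?g"
    proof (rule occupation_mono[OF s])
      fix g :: lamplighter_elem
      have "(\<Sum>a<q. of_bool (in_branch a (snd g)) :: real) \<le> (\<Sum>a<q. if a = hd (snd g) then 1 else 0)"
        by (intro sum_mono) auto
      also have "\<dots> \<le> 1" by (simp add: sum.delta)
      finally have "real q - 2 + (\<Sum>a<q. 2 * (lamp_behind a g + (- 1) * lamp_in_branch a g))
          \<le> (\<Sum>a<q. 1 - 2 * of_bool (in_branch a (snd g)) + 2 * lamp_behind a g - 2 * lamp_in_branch a g)"
        by (simp add: sum.distrib sum_subtractf algebra_simps flip: sum_distrib_left)
      then have "(1 - p) / real q * (real q - 2 + (\<Sum>a<q. 2 * (lamp_behind a g + (- 1) * lamp_in_branch a g)))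
          \<le> (1 - p) / real q * (\<Sum>a<q. 1 - 2 * of_bool (in_branch a (snd g)) + 2 * lamp_behind a g - 2 * lamp_in_branch a g)"
        using p_less by (intro mult_left_mono) auto
      then show "p + ((- 2 * p) * lamp_at_origin g + (1 - p) / real q * (real q - 2
        + (\<Sum>a<q. 2 * (lamp_behind a g + (- 1) * lamp_in_branch a g)))) \<le> tour_gain g"
        by (simp add: tour_gain_def right_diff_distrib)
    qed
    moreover have "occupation N (\<lambda>g. p + ((- 2 * p) * lamp_at_origin g + (1 - p) / real q * (real q - 2
        + (\<Sum>a<q. 2 * (lamp_behind a g + (- 1) * lamp_in_branch a g))))) ?g
      = p * real N - 2 * p * occupation N lamp_at_origin ?g
        + (1 - p) / real q * (real q - 2) * real N
        + (1 - p) / real q * (\<Sum>a<q. 2 * (occupation N (lamp_behind a) ?g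
              - occupation N (lamp_in_branch a) ?g))"
      unfolding occupation_add occupation_cmult occupation_const occupation_sum
      by (simp add: algebra_simps add_divide_distrib diff_divide_distrib)
    moreover have "2 * p * occupation N lamp_at_origin ?g \<le> 2 * p * (odd_prob * real N + 2 / drift)"
      using occupation_lamp_at_origin p_pos by (intro mult_left_mono) auto
    ultimately show ?thesis
      unfolding iterate_tour K_def by (simp only: distrib_left distrib_right right_diff_distrib left_diff_distrib)
  qed
  moreover have "p * (1 - 2 * odd_prob) + (1 - p) / real q * (real q - 2 + real q * (2 * (1 - F_one) * \<nu>))
      = (1 - p) * (real q - 2) / real q * (1 + 2 * real q / (real q - 1) * nu3_hat q p
          + p * real q / (p * real q + real q - 2))"
  proof -
    have "p * (1 - 2 * odd_prob) = (1 - p) * (real q - 2) / real q * (p * real q / (p * real q + real q - 2))"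
      using denom_pos q_ge by (simp add: odd_prob_def divide_simps) (simp add: algebra_simps)
    moreover have "2 * (1 - F_one) * \<nu> = (real q - 2) / (real q - 1) * (2 * \<nu>)"
      using q_ge by (simp add: F_one_def field_simps)
    ultimately show ?thesis
      using q_ge by (simp add: \<nu>_def distrib_left add_divide_distrib)
  qed
  ultimately show ?thesis by (simp only:) blast
qed

end

section \<open>Expectations of a random walk with finitely supported increments\<close>

lemma random_walk_cong:
  "(\<And>i. i \<in> {1..n} \<Longrightarrow> X i \<omega> = Y i \<omega>') \<Longrightarrow> random_walk G X n \<omega> = random_walk G Y n \<omega>'"
  by (induction n) auto

text \<open>Countability makes the multiplication measurable, and finiteness of the support makes every function
  of the walk at a fixed time integrable.\<close>

locale finite_range_walk = prob_space M for M :: "'w measure" +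
  fixes G :: "('a, 'b) monoid_scheme" and S :: "'a set" and \<mu> :: "'a \<Rightarrow> real"
    and X :: "nat \<Rightarrow> 'w \<Rightarrow> 'a"
  assumes countable_G: "countable (carrier G)"
    and mult_closed: "\<And>g h. g \<in> carrier G \<Longrightarrow> h \<in> carrier G \<Longrightarrow> g \<otimes>\<^bsub>G\<^esub> h \<in> carrier G"
    and one_closed: "\<one>\<^bsub>G\<^esub> \<in> carrier G"
    and finite_S: "finite S" and S_subset: "S \<subseteq> carrier G"
    and \<mu>_nonneg: "\<And>s. \<mu> s \<ge> 0" and \<mu>_outside: "\<And>s. s \<notin> S \<Longrightarrow> \<mu> s = 0"
    and indep: "indep_vars (\<lambda>_. count_space (carrier G)) X {1..}"
    and distr: "\<And>n. n \<ge> 1 \<Longrightarrow>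
       distributed M (count_space (carrier G)) (X n) (\<lambda>g. ennreal (\<mu> g))"
begin

abbreviation Z :: "nat \<Rightarrow> 'w \<Rightarrow> 'a" where "Z \<equiv> random_walk G X"

lemma random_walk_measurable:
  assumes "\<And>i. i \<in> {1..n} \<Longrightarrow> Y i \<in> N \<rightarrow>\<^sub>M count_space (carrier G)"
  shows "random_walk G Y n \<in> N \<rightarrow>\<^sub>M count_space (carrier G)"
  using assms
proof (induction n)
  case 0
  then show ?case using one_closed by simp
next
  case (Suc n)
  have "(\<lambda>(g, h). g \<otimes>\<^bsub>G\<^esub> h) \<in>
      count_space (carrier G) \<Otimes>\<^sub>M count_space (carrier G) \<rightarrow>\<^sub>M count_space (carrier G)"
    unfolding pair_measure_countable[OF countable_G countable_G]
    using mult_closed by auto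
  moreover have "(\<lambda>\<omega>. (random_walk G Y n \<omega>, Y (Suc n) \<omega>)) \<in>
      N \<rightarrow>\<^sub>M count_space (carrier G) \<Otimes>\<^sub>M count_space (carrier G)"
    using Suc by (intro measurable_Pair) auto
  ultimately have "(\<lambda>(g, h). g \<otimes>\<^bsub>G\<^esub> h) \<circ> (\<lambda>\<omega>. (random_walk G Y n \<omega>, Y (Suc n) \<omega>))
      \<in> N \<rightarrow>\<^sub>M count_space (carrier G)" by (rule measurable_comp[rotated])
  then show ?case by (simp add: comp_def)
qed

lemma X_measurable: "n \<ge> 1 \<Longrightarrow> X n \<in> M \<rightarrow>\<^sub>M count_space (carrier G)"
  using distr distributed_measurable by blast

lemma Z_measurable: "Z n \<in> M \<rightarrow>\<^sub>M count_space (carrier G)"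
  by (rule random_walk_measurable) (use X_measurable in auto)

lemma function_of_Z_measurable: "(\<lambda>\<omega>. f (Z n \<omega>)) \<in> M \<rightarrow>\<^sub>M borel"
  using measurable_comp[OF Z_measurable[of n], of f borel] by (simp add: comp_def)

lemma prob_increment:
  assumes "n \<ge> 1" "s \<in> carrier G"
  shows "expectation (\<lambda>\<omega>. of_bool (X n \<omega> = s)) = \<mu> s"
proof -
  have "emeasure M (X n -` {s} \<inter> space M) = ennreal (\<mu> s)"
    using distributed_emeasure[OF distr[OF assms(1)], of "{s}"] assms(2) by simp
  then have "prob (X n -` {s} \<inter> space M) = \<mu> s"
    by (simp add: measure_def \<mu>_nonneg)
  moreover have "expectation (\<lambda>\<omega>. of_bool (X n \<omega> = s) :: real)
      = expectation (indicator (X n -` {s} \<inter> space M))"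
    by (intro Bochner_Integration.integral_cong) (auto simp: indicator_def)
  ultimately show ?thesis by (simp only: Bochner_Integration.integral_indicator Int_assoc Int_absorb)
qed

lemma AE_increment:
  assumes "n \<ge> 1"
  shows "AE \<omega> in M. X n \<omega> \<in> S"
proof (rule AE_I)
  let ?B = "X n -` (carrier G - S) \<inter> space M"
  show "{\<omega> \<in> space M. X n \<omega> \<notin> S} \<subseteq> ?B"
    using measurable_space[OF X_measurable[OF assms]] by auto
  show "?B \<in> sets M" by (rule measurable_sets[OF X_measurable[OF assms]]) auto
  have "emeasure M ?B
      = (\<integral>\<^sup>+ x. ennreal (\<mu> x) * indicator (carrier G - S) x \<partial>count_space (carrier G))"
    by (rule distributed_emeasure[OF distr[OF assms]]) auto
  also have "\<dots> = (\<integral>\<^sup>+ x. 0 \<partial>count_space (carrier G))"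
    by (intro nn_integral_cong) (auto simp: indicator_def \<mu>_outside)
  finally show "emeasure M ?B = 0" by simp
qed

lemma AE_increments: "AE \<omega> in M. \<forall>i\<ge>1. X i \<omega> \<in> S"
  using AE_increment by (simp add: AE_all_countable AE_impI)

lemma integrable_function_of_Z: "integrable M (\<lambda>\<omega>. f (Z n \<omega>) :: real)"
proof -
  define R where "R = rec_nat {\<one>\<^bsub>G\<^esub>} (\<lambda>_ A. (\<lambda>(g, s). g \<otimes>\<^bsub>G\<^esub> s) ` (A \<times> S))"
  have R: "R 0 = {\<one>\<^bsub>G\<^esub>}" "R (Suc k) = (\<lambda>(g, s). g \<otimes>\<^bsub>G\<^esub> s) ` (R k \<times> S)" for k
    by (simp_all add: R_def)
  have fin: "finite (R k)" for k by (induction k) (auto simp: R finite_S)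
  have "Z k \<omega> \<in> R k" if "\<forall>i\<ge>1. X i \<omega> \<in> S" for k \<omega>
  proof (induction k)
    case (Suc k)
    then have "(Z k \<omega>, X (Suc k) \<omega>) \<in> R k \<times> S" using that by simp
    then show ?case by (force simp: R)
  qed (simp add: R)
  then have "\<bar>f (Z n \<omega>)\<bar> \<le> (\<Sum>g\<in>R n. \<bar>f g\<bar>)" if "\<forall>i\<ge>1. X i \<omega> \<in> S" for \<omega>
    using that fin by (intro member_le_sum[of "Z n \<omega>" "R n" "\<lambda>g. \<bar>f g\<bar>"]) auto
  then show ?thesis
    using AE_increments function_of_Z_measurable
    by (intro integrable_const_bound[where B = "\<Sum>g\<in>R n. \<bar>f g\<bar>"]) auto
qed

lemma indep_step:
  "indep_var (count_space (carrier G)) (Z n) (count_space (carrier G)) (X (Suc n))"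
proof -
  let ?C = "\<lambda>_ :: nat. count_space (carrier G)"
  have "indep_var (PiM {1..n} ?C) (\<lambda>\<omega>. restrict (\<lambda>i. X i \<omega>) {1..n})
          (PiM {Suc n} ?C) (\<lambda>\<omega>. restrict (\<lambda>i. X i \<omega>) {Suc n})"
    by (rule indep_var_restrict[OF indep]) auto
  then have "indep_var (count_space (carrier G))
      (random_walk G (\<lambda>i v. v i) n \<circ> (\<lambda>\<omega>. restrict (\<lambda>i. X i \<omega>) {1..n}))
      (count_space (carrier G)) ((\<lambda>v. v (Suc n)) \<circ> (\<lambda>\<omega>. restrict (\<lambda>i. X i \<omega>) {Suc n}))"
    by (rule indep_var_compose)
      (auto intro!: random_walk_measurable measurable_component_singleton)
  moreover have "random_walk G (\<lambda>i v. v i) n \<circ> (\<lambda>\<omega>. restrict (\<lambda>i. X i \<omega>) {1..n}) = Z n"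
    by (auto simp: fun_eq_iff intro!: random_walk_cong)
  ultimately show ?thesis by (simp add: comp_def)
qed

text \<open>The last increment is independent of the walk before it.\<close>

lemma expectation_step:
  fixes f :: "'a \<Rightarrow> real"
  shows "expectation (\<lambda>\<omega>. f (Z (Suc n) \<omega>))
    = expectation (\<lambda>\<omega>. \<Sum>s\<in>S. \<mu> s * f (Z n \<omega> \<otimes>\<^bsub>G\<^esub> s))"
proof -
  have int_f: "integrable M (\<lambda>\<omega>. f (Z n \<omega> \<otimes>\<^bsub>G\<^esub> s))" for s
    using integrable_function_of_Z[of "\<lambda>g. f (g \<otimes>\<^bsub>G\<^esub> s)" n] by simp
  have meas_X: "(\<lambda>\<omega>. of_bool (X (Suc n) \<omega> = s) :: real) \<in> M \<rightarrow>\<^sub>M borel" for s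
    using measurable_comp[OF X_measurable[of "Suc n"], of "\<lambda>g. of_bool (g = s)" borel]
    by (simp add: comp_def)
  have int_X: "integrable M (\<lambda>\<omega>. of_bool (X (Suc n) \<omega> = s) :: real)" for s
    by (rule integrable_const_bound[where B = 1]) (use meas_X in auto)
  have ind: "indep_var borel (\<lambda>\<omega>. f (Z n \<omega> \<otimes>\<^bsub>G\<^esub> s)) borel (\<lambda>\<omega>. of_bool (X (Suc n) \<omega> = s))"
    for s
    using indep_var_compose[OF indep_step[of n], of "\<lambda>g. f (g \<otimes>\<^bsub>G\<^esub> s)" borel "\<lambda>g. of_bool (g = s)" borel]
    by (simp add: comp_def)
  have "expectation (\<lambda>\<omega>. f (Z (Suc n) \<omega>))
      = expectation (\<lambda>\<omega>. \<Sum>s\<in>S. f (Z n \<omega> \<otimes>\<^bsub>G\<^esub> s) * of_bool (X (Suc n) \<omega> = s))"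
  proof (rule integral_cong_AE)
    show "AE \<omega> in M. f (Z (Suc n) \<omega>)
        = (\<Sum>s\<in>S. f (Z n \<omega> \<otimes>\<^bsub>G\<^esub> s) * of_bool (X (Suc n) \<omega> = s))"
    proof (rule eventually_mono[OF AE_increment[of "Suc n"]])
      fix \<omega> assume "X (Suc n) \<omega> \<in> S"
      then show "f (Z (Suc n) \<omega>) = (\<Sum>s\<in>S. f (Z n \<omega> \<otimes>\<^bsub>G\<^esub> s) * of_bool (X (Suc n) \<omega> = s))"
        using finite_S by (simp add: of_bool_def if_distrib sum.delta' cong: if_cong)
    qed simp
  qed (use function_of_Z_measurable int_f meas_X in
      \<open>auto intro!: borel_measurable_sum borel_measurable_times simp del: random_walk.simps\<close>)
  also have "\<dots> = (\<Sum>s\<in>S. expectation (\<lambda>\<omega>. f (Z n \<omega> \<otimes>\<^bsub>G\<^esub> s) * of_bool (X (Suc n) \<omega> = s)))"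
    by (rule Bochner_Integration.integral_sum) (rule indep_var_integrable[OF ind int_f int_X])
  also have "\<dots> = (\<Sum>s\<in>S. expectation (\<lambda>\<omega>. \<mu> s * f (Z n \<omega> \<otimes>\<^bsub>G\<^esub> s)))"
    using S_subset prob_increment[of "Suc n"]
    by (intro sum.cong refl) (auto simp: indep_var_lebesgue_integral[OF ind int_f int_X])
  also have "\<dots> = expectation (\<lambda>\<omega>. \<Sum>s\<in>S. \<mu> s * f (Z n \<omega> \<otimes>\<^bsub>G\<^esub> s))"
    by (rule Bochner_Integration.integral_sum[symmetric]) (use int_f in auto)
  finally show ?thesis .
qed

lemma word_length_le:
  assumes "\<forall>i\<ge>1. X i \<omega> \<in> S"
  shows "(Z n \<omega>, \<one>\<^bsub>G\<^esub>) \<in> cayley_edges G S ^^ n"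
proof (induction n)
  case (Suc n)
  have Z: "Z k \<omega> \<in> carrier G" for k
    using assms S_subset by (induction k) (auto intro!: mult_closed one_closed)
  have "(Z (Suc n) \<omega>, Z n \<omega>) \<in> cayley_edges G S"
    using Z[of n] Z[of "Suc n"] assms by (auto simp: cayley_edges_def)
  then show ?case using Suc by (rule relpow_Suc_I2)
qed simp

text \<open>The word length at time \<open>n\<close> is at most \<open>n\<close>, so by dominated convergence its mean divided by \<open>n\<close>
  tends to the rate of escape as well.\<close>

lemma rate_of_escape_ge:
  fixes f :: "'a \<Rightarrow> real"
  assumes rate: "is_rate_of_escape M G S Z l"
    and f: "\<And>n g. (g, \<one>\<^bsub>G\<^esub>) \<in> cayley_edges G S ^^ n \<Longrightarrow> f g \<le> real n"
    and drift: "\<And>n. expectation (\<lambda>\<omega>. f (Z n \<omega>)) \<ge> c * real n - K"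
  shows "l \<ge> c"
proof -
  let ?w = "\<lambda>n \<omega>. real (word_length G S (Z n \<omega>))"
  have w_le: "?w n \<omega> \<le> real n" if "\<forall>i\<ge>1. X i \<omega> \<in> S" for n \<omega>
    using word_length_le[OF that, of n] by (auto simp: word_length_def intro!: Least_le)
  have f_le: "f (Z n \<omega>) \<le> ?w n \<omega>" if "\<forall>i\<ge>1. X i \<omega> \<in> S" for n \<omega>
    unfolding word_length_def by (rule f, rule LeastI, rule word_length_le[OF that])
  have "(\<lambda>n. expectation (\<lambda>\<omega>. ?w n \<omega> / real n)) \<longlonglongrightarrow> expectation (\<lambda>\<omega>. l)"
  proof (rule integral_dominated_convergence[where w = "\<lambda>_. 1"])
    show "AE \<omega> in M. (\<lambda>n. ?w n \<omega> / real n) \<longlonglongrightarrow> l"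
      using rate by (simp add: is_rate_of_escape_def)
    show "AE \<omega> in M. norm (?w n \<omega> / real n) \<le> 1" for n
      by (rule eventually_mono[OF AE_increments]) (use w_le in \<open>auto simp: divide_le_eq_1\<close>)
  qed (auto intro!: function_of_Z_measurable)
  then have lim: "(\<lambda>n. expectation (\<lambda>\<omega>. ?w n \<omega> / real n)) \<longlonglongrightarrow> l" by (simp add: prob_space)
  have "(\<lambda>n. c - K / real n) \<longlonglongrightarrow> c - 0"
    by (intro tendsto_intros lim_const_over_n)
  moreover have "\<forall>n\<ge>1. c - K / real n \<le> expectation (\<lambda>\<omega>. ?w n \<omega> / real n)"
  proof (intro allI impI)
    fix n :: nat assume n: "n \<ge> 1"
    have "c * real n - K \<le> expectation (\<lambda>\<omega>. f (Z n \<omega>))" by (rule drift)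
    also have "\<dots> \<le> expectation (?w n)"
      by (intro integral_mono_AE integrable_function_of_Z eventually_mono[OF AE_increments] f_le)
    finally have "(c * real n - K) / real n \<le> expectation (?w n) / real n"
      by (rule divide_right_mono) simp
    then show "c - K / real n \<le> expectation (\<lambda>\<omega>. ?w n \<omega> / real n)"
      using n by (simp add: diff_divide_distrib)
  qed
  ultimately show ?thesis using LIMSEQ_le[OF _ lim, of _ c] by auto
qed

end

section \<open>The lamplighter walk\<close>

lemma lamplighter_mult:
  "(\<eta>, x) \<otimes>\<^bsub>lamplighter_group q\<^esub> (\<zeta>, y)
    = ((\<lambda>w. \<eta> w + translate q x \<zeta> w), x \<otimes>\<^bsub>tree_group q\<^esub> y)"
  "\<one>\<^bsub>lamplighter_group q\<^esub> = ((\<lambda>w. 0), [])"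
  by (simp_all add: lamplighter_group_def)

lemma lamplighter_mult_closed:
  assumes g: "g \<in> carrier (lamplighter_group q)" and h: "h \<in> carrier (lamplighter_group q)"
  shows "g \<otimes>\<^bsub>lamplighter_group q\<^esub> h \<in> carrier (lamplighter_group q)"
proof -
  interpret group "tree_group q" by (rule tree_group_is_group)
  obtain \<eta> x \<zeta> y where gh: "g = (\<eta>, x)" "h = (\<zeta>, y)" by (cases g, cases h) auto
  have \<eta>: "\<eta> \<in> lamp_configs q" and x: "x \<in> reduced_words q"
    and \<zeta>: "\<zeta> \<in> lamp_configs q" and y: "y \<in> reduced_words q"
    using g h by (auto simp: gh states_iff)
  have "{w. \<eta> w + translate q x \<zeta> w \<noteq> 0}
      \<subseteq> {w. \<eta> w \<noteq> 0} \<union> (\<lambda>v. x \<otimes>\<^bsub>tree_group q\<^esub> v) ` {w. \<zeta> w \<noteq> 0}"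
  proof
    fix w assume w: "w \<in> {w. \<eta> w + translate q x \<zeta> w \<noteq> 0}"
    show "w \<in> {w. \<eta> w \<noteq> 0} \<union> (\<lambda>v. x \<otimes>\<^bsub>tree_group q\<^esub> v) ` {w. \<zeta> w \<noteq> 0}"
    proof (cases "\<eta> w = 0")
      case True
      then have "w \<in> reduced_words q" "\<zeta> (inv\<^bsub>tree_group q\<^esub> x \<otimes>\<^bsub>tree_group q\<^esub> w) \<noteq> 0"
        using w by (auto simp: translate_def split: if_splits)
      moreover from this have "w = x \<otimes>\<^bsub>tree_group q\<^esub> (inv\<^bsub>tree_group q\<^esub> x \<otimes>\<^bsub>tree_group q\<^esub> w)"
        using x by (simp flip: m_assoc)
      ultimately show ?thesis by blast
    qed simp
  qed
  moreover have "finite ({w. \<eta> w \<noteq> 0} \<union> (\<lambda>v. x \<otimes>\<^bsub>tree_group q\<^esub> v) ` {w. \<zeta> w \<noteq> 0})"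
    using \<eta> \<zeta> by (simp add: lamp_configs_def)
  moreover have "{w. \<eta> w \<noteq> 0} \<union> (\<lambda>v. x \<otimes>\<^bsub>tree_group q\<^esub> v) ` {w. \<zeta> w \<noteq> 0} \<subseteq> reduced_words q"
    using \<eta> \<zeta> x by (auto simp: lamp_configs_def)
  ultimately have "(\<lambda>w. \<eta> w + translate q x \<zeta> w) \<in> lamp_configs q"
    unfolding lamp_configs_def mem_Collect_eq by (meson finite_subset subset_trans)
  then show ?thesis using x y by (simp add: gh lamplighter_mult states_iff)
qed

lemma countable_lamplighter: "countable (carrier (lamplighter_group q))"
proof -
  have "inj_on (\<lambda>\<eta>. {w. \<eta> w \<noteq> 0}) (lamp_configs q)"
  proof (rule inj_onI)
    fix \<eta> \<zeta> :: "nat list \<Rightarrow> bit"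
    assume "{w. \<eta> w \<noteq> 0} = {w. \<zeta> w \<noteq> 0}"
    then have eq: "\<eta> w \<noteq> 0 \<longleftrightarrow> \<zeta> w \<noteq> 0" for w by blast
    show "\<eta> = \<zeta>"
    proof
      fix w
      show "\<eta> w = \<zeta> w" using eq[of w] by (cases "\<eta> w"; cases "\<zeta> w") auto
    qed
  qed
  moreover have "countable ((\<lambda>\<eta>. {w. \<eta> w \<noteq> 0}) ` lamp_configs q)"
    by (rule countable_subset[OF _ countable_Collect_finite]) (auto simp: lamp_configs_def)
  ultimately have "countable (lamp_configs q)" by (rule countable_image_inj_on[rotated])
  then show ?thesis by (simp add: lamplighter_group_def)
qed

lemma mult_switch_gen:
  assumes "(\<eta>, x) \<in> carrier (lamplighter_group q)"
  shows "(\<eta>, x) \<otimes>\<^bsub>lamplighter_group q\<^esub> switch_gen = (\<eta>(x := \<eta> x + 1), x)"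
proof -
  interpret group "tree_group q" by (rule tree_group_is_group)
  have x: "x \<in> reduced_words q" using assms by (simp add: states_iff)
  have "translate q x (indicator {[]}) = indicator {x}"
    using x inv_mult_eq_Nil by (auto simp: translate_def indicator_def fun_eq_iff)
  moreover have "x \<otimes>\<^bsub>tree_group q\<^esub> [] = x" using r_one[OF x] by (simp add: tree_group_simps)
  ultimately show ?thesis
    by (auto simp: switch_gen_def lamplighter_mult fun_eq_iff indicator_def)
qed

lemma mult_move_gen:
  "(\<eta>, x) \<otimes>\<^bsub>lamplighter_group q\<^esub> move_gen a = (\<eta>, neighbour x a)"
proof -
  have "translate q x (\<lambda>w. 0) = (\<lambda>w. 0)" by (simp add: translate_def fun_eq_iff)
  then show ?thesis
    by (simp only: move_gen_def lamplighter_mult neighbour_def tree_group_simps add_0_right)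
qed

lemma gens_subset: "lamplighter_gens q \<subseteq> carrier (lamplighter_group q)"
proof -
  have "indicator {[]} \<in> lamp_configs q"
  proof -
    have "indicator {[]} = (\<lambda>w :: nat list. 0 :: bit)([] := 1)" by (auto simp: indicator_def)
    then show ?thesis by (simp only: lamp_configs_upd lamp_configs_zero Nil_reduced)
  qed
  then show ?thesis
    by (auto simp: lamplighter_gens_def switch_gen_def move_gen_def states_iff reduced_Cons)
qed

context lamplighter_walk
begin

lemma sum_law:
  assumes "g \<in> states"
  shows "(\<Sum>s\<in>lamplighter_gens q. lamplighter_law q p s * f (g \<otimes>\<^bsub>lamplighter_group q\<^esub> s))
    = walk_op f g"
proof (cases g)
  case (Pair \<eta> x)
  have ne: "switch_gen \<noteq> move_gen a" for a
    by (simp add: switch_gen_def move_gen_def)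
  have inj: "inj_on move_gen {..<q}" by (auto simp: inj_on_def move_gen_def)
  have law: "lamplighter_law q p switch_gen = p"
    "a < q \<Longrightarrow> lamplighter_law q p (move_gen a) = (1 - p) / real q" for a
    using ne[of a] by (auto simp: lamplighter_law_def)
  have "(\<Sum>s\<in>lamplighter_gens q. lamplighter_law q p s * f (g \<otimes>\<^bsub>lamplighter_group q\<^esub> s))
      = p * f (\<eta>(x := \<eta> x + 1), x)
        + (\<Sum>s\<in>move_gen ` {..<q}. lamplighter_law q p s * f (g \<otimes>\<^bsub>lamplighter_group q\<^esub> s))"
    using ne assms unfolding lamplighter_gens_def
    by (subst sum.insert) (auto simp: law Pair mult_switch_gen)
  also have "(\<Sum>s\<in>move_gen ` {..<q}. lamplighter_law q p s * f (g \<otimes>\<^bsub>lamplighter_group q\<^esub> s))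
      = (1 - p) / real q * (\<Sum>a<q. f (\<eta>, neighbour x a))"
    unfolding sum.reindex[OF inj] sum_distrib_left
    by (intro sum.cong refl) (simp add: law Pair mult_move_gen)
  finally show ?thesis by (simp only: Pair walk_op_apply)
qed

lemma tour_gen:
  assumes "g \<in> states" "s \<in> lamplighter_gens q"
  shows "\<bar>tour (g \<otimes>\<^bsub>lamplighter_group q\<^esub> s) - tour g\<bar> = 1"
proof (cases g)
  case (Pair \<eta> x)
  then have x: "x \<in> reduced_words q" and fin: "finite {w. \<eta> w \<noteq> 0}"
    using assms(1) by (auto simp: states_iff lamp_configs_def)
  show ?thesis
  proof (cases "s = switch_gen")
    case True
    then show ?thesis
      using assms(1) tour_switch[OF fin, of x x] unfolding Pair
      by (simp only: mult_switch_gen) simp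
  next
    case False
    then obtain a where "s = move_gen a" using assms(2) by (auto simp: lamplighter_gens_def)
    then show ?thesis using tour_neighbour[OF fin x] by (simp add: Pair mult_move_gen)
  qed
qed

lemma tour_le_path_length:
  assumes "(g, \<one>\<^bsub>lamplighter_group q\<^esub>)
    \<in> cayley_edges (lamplighter_group q) (lamplighter_gens q) ^^ n"
  shows "tour g \<le> real n"
  using assms
proof (induction n arbitrary: g)
  case 0
  then show ?case by (simp add: lamplighter_mult tour_def detour_def)
next
  case (Suc n)
  then obtain h where edge: "(g, h) \<in> cayley_edges (lamplighter_group q) (lamplighter_gens q)"
    and h: "tour h \<le> real n" by (meson relpow_Suc_D2)
  from edge obtain s where "s \<in> lamplighter_gens q" "g \<in> states" "h \<in> states"
    "h = g \<otimes>\<^bsub>lamplighter_group q\<^esub> s \<or> g = h \<otimes>\<^bsub>lamplighter_group q\<^esub> s"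
    by (auto simp: cayley_edges_def)
  then have "\<bar>tour g - tour h\<bar> = 1" using tour_gen by (metis abs_minus_commute)
  then show ?case using h by simp
qed

end

theorem mainTheorem4:
  fixes q :: nat and p l :: real
    and M :: "'w measure" and X :: "nat \<Rightarrow> 'w \<Rightarrow> lamplighter_elem"
  assumes "q \<ge> 3" and "0 < p" and "p < 1"
    and "prob_space M"
    and "prob_space.indep_vars M (\<lambda>_. count_space (carrier (lamplighter_group q))) X {1..}"
    and "\<And>n. n \<ge> 1 \<Longrightarrow>
           distributed M (count_space (carrier (lamplighter_group q))) (X n)
             (\<lambda>g. ennreal (lamplighter_law q p g))"
    and "is_rate_of_escape M (lamplighter_group q) (lamplighter_gens q)
           (random_walk (lamplighter_group q) X) l"
  shows "l \<ge> (1 - p) * (real q - 2) / real q *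
               (1 + 2 * real q / (real q - 1) * nu3_hat q p
                  + p * real q / (p * real q + real q - 2))"
proof -
  interpret lamplighter_walk q p using assms by unfold_locales
  interpret prob_space M by fact
  interpret finite_range_walk M "lamplighter_group q" "lamplighter_gens q" "lamplighter_law q p" X
  proof
    show "finite (lamplighter_gens q)" by (simp add: lamplighter_gens_def)
    show "\<one>\<^bsub>lamplighter_group q\<^esub> \<in> states" by (simp add: lamplighter_mult states_iff)
    show "lamplighter_law q p s \<ge> 0" for s using assms by (simp add: lamplighter_law_def)
    show "s \<notin> lamplighter_gens q \<Longrightarrow> lamplighter_law q p s = 0" for s
      by (auto simp: lamplighter_law_def lamplighter_gens_def)
  qed (use assms countable_lamplighter lamplighter_mult_closed gens_subset in auto)
  have "expectation (\<lambda>\<omega>. f (Z n \<omega>)) = (walk_op ^^ n) f ((\<lambda>w. 0), [])" for f n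
  proof (induction n arbitrary: f)
    case 0
    then show ?case by (simp add: lamplighter_mult prob_space)
  next
    case (Suc n)
    have "expectation (\<lambda>\<omega>. f (Z (Suc n) \<omega>)) = expectation (\<lambda>\<omega>. walk_op f (Z n \<omega>))"
      unfolding expectation_step using measurable_space[OF Z_measurable]
      by (intro Bochner_Integration.integral_cong refl sum_law) auto
    then show ?case using Suc by (simp add: funpow_swap1)
  qed
  moreover obtain K where "\<And>N. (walk_op ^^ N) tour ((\<lambda>w. 0), []) \<ge>
     (1 - p) * (real q - 2) / real q *
       (1 + 2 * real q / (real q - 1) * nu3_hat q p + p * real q / (p * real q + real q - 2))
     * real N - K" using iterate_tour_ge by blast
  ultimately have "expectation (\<lambda>\<omega>. tour (Z N \<omega>)) \<ge> (1 - p) * (real q - 2) / real q *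
       (1 + 2 * real q / (real q - 1) * nu3_hat q p + p * real q / (p * real q + real q - 2))
     * real N - K" for N by simp
  from rate_of_escape_ge[OF assms(7) _ this] show ?thesis using tour_le_path_length by blast
qed

end
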